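(* Let $x_0, x_1, \ldots, x_{n-1} \in \{0,1\}^{m}$ be $n$ binary vectors such that $x_0$ and $x_1$ is the unique pair achieving the minimum pairwise Hamming distance $d_{\min}$ (the second smallest pairwise distance may be as small as $d_{\min}+1$). Suppose the value of $d_{\min}$ is given as input, and let $\delta := d_{\min}/m$. Then there is a randomized algorithm running in time $O\big(n\log^{2}n\cdot 2^{(1-\kappa_{Z}(\delta)-\delta)m} \cdot \mathrm{poly}(m)\big)$ which finds the closest pair $x_0$ and $x_1$ with probability at least $1-1/n^2$.
   Context: The Hamming distance between $x,y\in\{0,1\}^m$ is $\mathrm{dist}(x,y)=|\{k\in[m]:(x)_k\neq (y)_k\}|$. All logarithms are base 2. $H_2(p) = -p\log p-(1-p)\log(1-p)$ is the binary entropy function and $H_2^{-1}$ denotes its inverse on $[0,1/2]$. $\kappa_{Z}(\delta)$ denotes the maximum rate given by the Zyablov bound as a function of relative distance $\delta\in[0,1/2]$: $\kappa_Z(\delta) = \max_{0<r<1-H_2(\delta)} r\left(1-\frac{\delta}{H_2^{-1}(1-r)}\right)$. $\mathrm{poly}(m)$ denotes a polynomial in $m$. *)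

theory Defs
  imports "HOL-Probability.Probability" "HOL-Library.Log_Nat"
    "HOL-Computational_Algebra.Polynomial"
begin

section \<open>Binary vectors and closest pairs\<close>

definition hdist :: "bool list \<Rightarrow> bool list \<Rightarrow> nat" where
  "hdist u v = card {k. k < length u \<and> u ! k \<noteq> v ! k}"

definition index_pairs :: "'a list \<Rightarrow> (nat \<times> nat) set" where
  "index_pairs xs = {(i, j). i < j \<and> j < length xs}"

definition min_dist :: "bool list list \<Rightarrow> nat" where
  "min_dist xs = Min ((\<lambda>(i, j). hdist (xs ! i) (xs ! j)) ` index_pairs xs)"

definition unique_closest_pair :: "bool list list \<Rightarrow> nat \<Rightarrow> nat \<Rightarrow> bool" where
  "unique_closest_pair xs a b \<longleftrightarrow>
     {(i, j) \<in> index_pairs xs. hdist (xs ! i) (xs ! j) = min_dist xs} = {(a, b)}"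


section \<open>The Zyablov bound\<close>

text \<open>Since \<open>log 2 0 = 0\<close>, the usual convention \<open>0 log 0 = 0\<close> is built in.\<close>

definition H2 :: "real \<Rightarrow> real" where
  "H2 p = - p * log 2 p - (1 - p) * log 2 (1 - p)"

definition H2_inv :: "real \<Rightarrow> real" where
  "H2_inv = the_inv_into {0..1/2} H2"

text \<open>
  A supremum is used because the maximum over the open interval is not attained at \<open>\<delta> = 0\<close>
  (where the supremum is 1). At \<open>\<delta> = 1/2\<close> the interval is empty and the rate is 0,
  the limit of the values for \<open>\<delta> < 1/2\<close>.
\<close>

definition zyablov :: "real \<Rightarrow> real" where
  "zyablov \<delta> =
     (if \<delta> < 1/2 then SUP r \<in> {0<..<1 - H2 \<delta>}. r * (1 - \<delta> / H2_inv (1 - r)) else 0)"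


section \<open>Randomized random access programs with logarithmic cost\<close>

text \<open>
  Structured programs over natural-number registers and zero-initialised unbounded arrays with
  computed indices. The names of registers and arrays are constants of the program text, so a
  program uses only finitely many of them. Costs follow the logarithmic cost criterion: an
  operation is charged for the binary lengths of the numbers and array indices it touches
  (multiplication and division are charged for the schoolbook bit cost), so large numbers give
  no free parallelism.
\<close>

datatype bop = Add | Sub | Mul | Quo | Rem | Less | Eq

datatype aexp =
    Const nat
  | Reg nat
  | Read nat aexp
  | Op bop aexp aexp

datatype com =
    Skip
  | Assign nat aexp
  | Write nat aexp aexp
  | Flip nat
  | Seq com com
  | If aexp com com
  | While aexp com

record store =
  regs :: "nat \<Rightarrow> nat"
  arrs :: "nat \<Rightarrow> nat \<Rightarrow> nat"

definition blen :: "nat \<Rightarrow> nat" where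
  "blen k = max 1 (floorlog 2 k)"

fun bop_val :: "bop \<Rightarrow> nat \<Rightarrow> nat \<Rightarrow> nat" where
  "bop_val Add a b = a + b"
| "bop_val Sub a b = a - b"
| "bop_val Mul a b = a * b"
| "bop_val Quo a b = a div b"
| "bop_val Rem a b = a mod b"
| "bop_val Less a b = of_bool (a < b)"
| "bop_val Eq a b = of_bool (a = b)"

fun bop_cost :: "bop \<Rightarrow> nat \<Rightarrow> nat \<Rightarrow> nat" where
  "bop_cost Add a b = blen a + blen b"
| "bop_cost Sub a b = blen a + blen b"
| "bop_cost Mul a b = blen a * blen b"
| "bop_cost Quo a b = blen a * blen b"
| "bop_cost Rem a b = blen a * blen b"
| "bop_cost Less a b = blen a + blen b"
| "bop_cost Eq a b = blen a + blen b"

fun aval :: "aexp \<Rightarrow> store \<Rightarrow> nat" where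
  "aval (Const k) s = k"
| "aval (Reg x) s = regs s x"
| "aval (Read A e) s = arrs s A (aval e s)"
| "aval (Op f e1 e2) s = bop_val f (aval e1 s) (aval e2 s)"

fun acost :: "aexp \<Rightarrow> store \<Rightarrow> nat" where
  "acost (Const k) s = blen k"
| "acost (Reg x) s = blen (regs s x)"
| "acost (Read A e) s = acost e s + blen (aval e s) + blen (arrs s A (aval e s))"
| "acost (Op f e1 e2) s = acost e1 s + acost e2 s + bop_cost f (aval e1 s) (aval e2 s)"

text \<open>
  A configuration consists of the commands still to be executed (the head first), the store,
  and the time spent so far. It is final iff no command is left; every other step takes at
  least one unit of time. Guards are true iff they are nonzero; \<open>Flip\<close> tosses a fair coin.
\<close>

type_synonym config = "com list \<times> store \<times> nat"

definition set_reg :: "nat \<Rightarrow> nat \<Rightarrow> store \<Rightarrow> store" where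
  "set_reg x v s = s\<lparr>regs := (regs s)(x := v)\<rparr>"

definition set_arr :: "nat \<Rightarrow> nat \<Rightarrow> nat \<Rightarrow> store \<Rightarrow> store" where
  "set_arr A i v s = s\<lparr>arrs := (arrs s)(A := (arrs s A)(i := v))\<rparr>"

fun step :: "config \<Rightarrow> config pmf" where
  "step ([], s, t) = return_pmf ([], s, t)"
| "step (Skip # K, s, t) = return_pmf (K, s, t + 1)"
| "step (Assign x e # K, s, t) =
     return_pmf (K, set_reg x (aval e s) s, t + acost e s + blen (aval e s))"
| "step (Write A e1 e2 # K, s, t) =
     return_pmf (K, set_arr A (aval e1 s) (aval e2 s) s,
       t + acost e1 s + acost e2 s + blen (aval e1 s) + blen (aval e2 s))"
| "step (Flip x # K, s, t) =
     map_pmf (\<lambda>b. (K, set_reg x (of_bool b) s, t + 1)) (bernoulli_pmf (1/2))"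
| "step (Seq c1 c2 # K, s, t) = return_pmf (c1 # c2 # K, s, t + 1)"
| "step (If e c1 c2 # K, s, t) =
     return_pmf ((if aval e s \<noteq> 0 then c1 else c2) # K, s, t + acost e s)"
| "step (While e c # K, s, t) =
     return_pmf (if aval e s \<noteq> 0 then c # While e c # K else K, s, t + acost e s)"

fun run :: "nat \<Rightarrow> config \<Rightarrow> config pmf" where
  "run 0 cfg = return_pmf cfg"
| "run (Suc k) cfg = bind_pmf (step cfg) (run k)"

text \<open>
  The running time is worst case over the coin tosses. As each step takes time at least 1,
  a computation that takes time at most \<open>T\<close> has stopped after at most \<open>T\<close> steps.
\<close>

definition halts_within :: "com \<Rightarrow> store \<Rightarrow> nat \<Rightarrow> bool" where
  "halts_within P s T \<longleftrightarrow>
     (\<forall>(K, s', t) \<in> set_pmf (run T ([P], s, 0)). K = [] \<and> t \<le> T)"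

definition output_after :: "com \<Rightarrow> store \<Rightarrow> nat \<Rightarrow> (nat \<times> nat) pmf" where
  "output_after P s T = map_pmf (\<lambda>(K, s', t). (regs s' 0, regs s' 1)) (run T ([P], s, 0))"

text \<open>
  Input convention: the number of vectors, their length and the minimum distance are in
  registers 0, 1 and 2; bit \<open>k\<close> of vector \<open>i\<close> is in cell \<open>i * m + k\<close> of array 0; everything
  else is 0.
\<close>

definition input_store :: "nat \<Rightarrow> nat \<Rightarrow> nat \<Rightarrow> bool list list \<Rightarrow> store" where
  "input_store n m d xs = \<lparr>
     regs = (\<lambda>_. 0)(0 := n, 1 := m, 2 := d),
     arrs = (\<lambda>A j. if A = 0 \<and> j < n * m then of_bool (xs ! (j div m) ! (j mod m)) else 0)\<rparr>"

end

theory Submission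
  imports Defs
begin

text \<open>
  Codes and coin tosses can be avoided. For every \<open>r < 1 - H2 \<delta>\<close> the factor of \<open>r\<close> in the Zyablov
  expression is at most 1, so \<open>\<kappa>\<^sub>Z(\<delta>) \<le> 1 - H2 \<delta>\<close>, and time \<open>n 2 ^ ((H2 \<delta> - \<delta>) m)\<close> up to
  factors \<open>poly(m, log n)\<close> suffices. Two deterministic algorithms achieve this.

  For \<open>\<delta> > 3/13\<close> compare all pairs: the vectors form a code of distance \<open>d\<close>, so by the Plotkin
  bound \<open>n \<le> 2 ^ (m + 1 - 2 d) 2 d\<close>, and \<open>1 - 2 \<delta> \<le> H2 \<delta> - \<delta>\<close> in this range.

  For \<open>\<delta> \<le> 3/13\<close> list the ball of radius \<open>\<lceil>d/2\<rceil>\<close> around every vector. A word in the ball of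
  radius \<open>\<lceil>d/2\<rceil>\<close> around one vector and the ball of radius \<open>\<lfloor>d/2\<rfloor>\<close> around another shows that the two
  have distance at most \<open>d\<close>, and a midpoint of the closest pair is such a word. By Chernoff's
  argument the balls have \<open>\<le> y powr (- d/2) (1 + y) ^ m\<close> elements up to a factor \<open>m\<close>, and
  \<open>y = 2 (\<delta> / (1 - \<delta>))\<^sup>2\<close> makes this at most \<open>2 ^ ((H2 \<delta> - \<delta>) m)\<close>.
\<close>

section \<open>Cost of coin-free programs\<close>

lemma blen_pos: "1 \<le> blen k"
  by (simp add: blen_def)

lemma blen_le_iff: "1 \<le> B \<Longrightarrow> blen v \<le> B \<longleftrightarrow> v < 2 ^ B"
  by (cases "v = 0") (auto simp: blen_def floorlog_le_iff)

lemma less_power_blen: "v < 2 ^ blen v"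
  using blen_le_iff[OF blen_pos] by blast

lemma blen_mono: "u \<le> v \<Longrightarrow> blen u \<le> blen v"
  using le_less_trans[OF _ less_power_blen] blen_le_iff[OF blen_pos] by blast

text \<open>A product is no longer than its factors together, and
  \<open>u + v + 1 \<le> (u + 1) * (v + 1)\<close> treats a sum like a product. All other operations
  return at most \<open>u\<close> or at most 1.\<close>

lemma blen_bop_val: "blen (bop_val f u v) \<le> blen u + blen v"
proof -
  have u: "u < 2 ^ blen u" and v: "v < 2 ^ blen v" by (rule less_power_blen)+
  have pos: "1 \<le> blen u" "1 \<le> blen v" by (rule blen_pos)+
  have mul: "u * v < 2 ^ (blen u + blen v)"
    using mult_strict_mono'[OF u v] by (simp add: power_add)
  have "u + v < 2 ^ (blen u + blen v)"
  proof -
    have "u + v + 1 \<le> (u + 1) * (v + 1)" by simp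
    also have "\<dots> \<le> 2 ^ blen u * 2 ^ blen v" using u v by (intro mult_mono) auto
    finally show ?thesis by (simp add: power_add)
  qed
  moreover have "u < 2 ^ (blen u + blen v)"
    using u by (rule less_le_trans) (simp add: power_increasing)
  moreover have "1 < (2::nat) ^ (blen u + blen v)" using pos by (intro one_less_power) auto
  ultimately show ?thesis using mul pos
    by (subst blen_le_iff; cases f)
       (auto simp: of_bool_def intro: le_less_trans[OF div_le_dividend] le_less_trans[OF mod_less_eq_dividend])
qed

text \<open>Factor by which a value may be longer than the stored numbers. A \<open>Read\<close>
  keeps the weight of its index, although its value is a single cell, because
  \<open>acost_le\<close> must also pay for computing the index.\<close>

fun expr_weight :: "aexp \<Rightarrow> nat" where
  "expr_weight (Const k) = blen k"
| "expr_weight (Reg x) = 1"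
| "expr_weight (Read A e) = expr_weight e + 1"
| "expr_weight (Op f e1 e2) = expr_weight e1 + expr_weight e2"

lemma expr_weight_pos: "1 \<le> expr_weight e"
  by (induction e) (auto simp: blen_pos[simplified])

definition bounded_store :: "nat \<Rightarrow> store \<Rightarrow> bool" where
  "bounded_store B s \<longleftrightarrow> 1 \<le> B \<and> (\<forall>x. blen (regs s x) \<le> B) \<and> (\<forall>A i. blen (arrs s A i) \<le> B)"

lemma bounded_storeD:
  assumes "bounded_store B s"
  shows "1 \<le> B" "blen (regs s x) \<le> B" "blen (arrs s A i) \<le> B"
  using assms by (auto simp: bounded_store_def)

lemma blen_aval:
  assumes "bounded_store B s"
  shows "blen (aval e s) \<le> expr_weight e * B"
proof (induction e)
  case (Const k)
  then show ?case using bounded_storeD(1)[OF assms] by simp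
next
  case (Reg x)
  then show ?case using bounded_storeD(2)[OF assms] by simp
next
  case (Read A e)
  then show ?case using bounded_storeD(3)[OF assms] by (simp add: trans_le_add1)
next
  case (Op f e1 e2)
  then show ?case
    using blen_bop_val[of f "aval e1 s" "aval e2 s"] by (simp add: add_mult_distrib)
qed

text \<open>The square reflects the schoolbook charge for \<open>Mul\<close>, \<open>Quo\<close> and
  \<open>Rem\<close>. In the induction the cross term of the square of a sum pays for the operation
  at the root.\<close>

lemma acost_le:
  assumes "bounded_store B s"
  shows "acost e s \<le> 3 * (expr_weight e * B)\<^sup>2"
proof (induction e)
  case (Const k)
  have "blen k \<le> blen k * B" using bounded_storeD(1)[OF assms] by simp
  also have "\<dots> \<le> (blen k * B)\<^sup>2" by (simp add: power2_nat_le_imp_le power2_eq_square)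
  finally show ?case by simp
next
  case (Reg x)
  have "blen (regs s x) \<le> B" by (rule bounded_storeD(2)[OF assms])
  also have "B \<le> B\<^sup>2" by (simp add: power2_eq_square)
  finally show ?case by simp
next
  case (Read A e)
  define w where "w = expr_weight e * B"
  have "acost (Read A e) s \<le> 3 * w\<^sup>2 + w + B"
    using Read blen_aval[OF assms, of e] bounded_storeD(3)[OF assms, of A "aval e s"]
    by (simp add: w_def)
  also have "\<dots> \<le> 3 * (w + B)\<^sup>2"
  proof -
    have "w \<le> w * B" "B \<le> B * B" using bounded_storeD(1)[OF assms] by simp_all
    then show ?thesis unfolding power2_eq_square distrib_left distrib_right by linarith
  qed
  finally show ?case by (simp add: w_def add_mult_distrib add.commute)
next
  case (Op f e1 e2)
  define u where "u = expr_weight e1 * B"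
  define v where "v = expr_weight e2 * B"
  have uv: "blen (aval e1 s) \<le> u" "blen (aval e2 s) \<le> v"
    unfolding u_def v_def by (rule blen_aval[OF assms])+
  have le: "blen (aval e1 s) * blen (aval e2 s) \<le> u * v" using uv by (rule mult_le_mono)
  have pos: "1 \<le> u" "1 \<le> v"
    using uv blen_pos[of "aval e1 s"] blen_pos[of "aval e2 s"] by linarith+
  have "u + v \<le> u * v + 1"
  proof -
    obtain u' v' where "u = Suc u'" "v = Suc v'" using pos by (metis Suc_le_D One_nat_def)
    then show ?thesis by simp
  qed
  also have "\<dots> \<le> 2 * (u * v)" using pos mult_le_mono[OF pos] by simp
  finally have "bop_cost f (aval e1 s) (aval e2 s) \<le> 2 * (u * v)"
    using le uv by (cases f) simp_all
  then have "acost (Op f e1 e2) s \<le> 3 * u\<^sup>2 + 3 * v\<^sup>2 + 2 * (u * v)"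
    using Op by (simp add: u_def v_def)
  also have "\<dots> \<le> 3 * (u + v)\<^sup>2" by (simp add: power2_eq_square algebra_simps)
  finally show ?case by (simp add: u_def v_def add_mult_distrib)
qed

section \<open>Cost of a single step and of a whole coin-free run\<close>

fun com_weight :: "com \<Rightarrow> nat" where
  "com_weight Skip = 1"
| "com_weight (Assign x e) = 4 * (expr_weight e)\<^sup>2"
| "com_weight (Write A e1 e2) = 4 * (expr_weight e1 + expr_weight e2)\<^sup>2"
| "com_weight (Flip x) = 1"
| "com_weight (Seq c1 c2) = com_weight c1 + com_weight c2"
| "com_weight (If e c1 c2) = 3 * (expr_weight e)\<^sup>2 + com_weight c1 + com_weight c2"
| "com_weight (While e c) = 3 * (expr_weight e)\<^sup>2 + com_weight c"

lemma com_weight_pos: "1 \<le> com_weight c"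
proof (induction c)
  case (Assign x e)
  show ?case using expr_weight_pos[of e] by (simp add: Suc_le_eq)
next
  case (Write A e1 e2)
  show ?case using expr_weight_pos[of e1] by (simp add: Suc_le_eq)
qed auto

text \<open>
  \<open>exec B c s s' k\<close>: the coin-free run of \<open>c\<close> takes \<open>k\<close> steps and stores only numbers of binary
  length at most \<open>B\<close>. Each of these steps then costs at most \<open>com_weight c * B\<^sup>2\<close>.
\<close>

inductive exec :: "nat \<Rightarrow> com \<Rightarrow> store \<Rightarrow> store \<Rightarrow> nat \<Rightarrow> bool" for B where
  exec_Skip: "exec B Skip s s 1"
| exec_Assign: "blen (aval e s) \<le> B \<Longrightarrow> exec B (Assign x e) s (set_reg x (aval e s) s) 1"
| exec_Write: "blen (aval e2 s) \<le> B \<Longrightarrow>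
    exec B (Write A e1 e2) s (set_arr A (aval e1 s) (aval e2 s) s) 1"
| exec_Seq: "exec B c1 s s1 k1 \<Longrightarrow> exec B c2 s1 s2 k2 \<Longrightarrow> exec B (Seq c1 c2) s s2 (1 + (k1 + k2))"
| exec_If: "exec B (if aval e s \<noteq> 0 then c1 else c2) s s' k \<Longrightarrow> exec B (If e c1 c2) s s' (1 + k)"
| exec_While_end: "aval e s = 0 \<Longrightarrow> exec B (While e c) s s 1"
| exec_While_step: "aval e s \<noteq> 0 \<Longrightarrow> exec B c s s1 k1 \<Longrightarrow> exec B (While e c) s1 s2 k2 \<Longrightarrow>
    exec B (While e c) s s2 (1 + (k1 + k2))"

lemma run_add: "run (j + k) cfg = bind_pmf (run j cfg) (run k)"
proof (induction j arbitrary: cfg)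
  case 0
  show ?case by (simp add: bind_return_pmf)
next
  case (Suc j)
  have "run (j + k) = (\<lambda>cfg. bind_pmf (run j cfg) (run k))" by (rule ext) (rule Suc)
  then show ?case by (simp add: bind_assoc_pmf)
qed

lemma run_halted: "run k ([], s, t) = return_pmf ([], s, t)"
  by (induction k) (auto simp: bind_return_pmf)

text \<open>Evaluation takes at most three squares; the fourth absorbs the charge for a stored value
  of length \<open>B\<close>. This explains the factor 4 in \<open>com_weight\<close>.\<close>

lemma blen_sq_bound: "1 \<le> a \<Longrightarrow> 1 \<le> B \<Longrightarrow> 3 * (a * B)\<^sup>2 + B \<le> 4 * a\<^sup>2 * (B::nat)\<^sup>2"
proof -
  assume "1 \<le> a" "1 \<le> B"
  then have "1 * B \<le> (a\<^sup>2 * B) * B" by (intro mult_le_mono1) (simp add: Suc_le_eq)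
  then show ?thesis by (simp add: power_mult_distrib power2_eq_square)
qed

text \<open>The continuation \<open>K\<close> and the clock \<open>t\<close> stay arbitrary so that
  runs of subcommands compose. \<open>W\<close> may exceed \<open>com_weight c\<close>, so that one
  price per step serves a command and all its parts.\<close>

lemma exec_run:
  assumes "exec B c s s' k" "bounded_store B s" "com_weight c \<le> W"
  shows "bounded_store B s' \<and>
    (\<forall>K t. \<exists>t' \<le> t + k * (W * B\<^sup>2). run k (c # K, s, t) = return_pmf (K, s', t'))"
  using assms
proof (induction arbitrary: W rule: exec.induct)
  case (exec_Skip s)
  have "1 \<le> W * B\<^sup>2" using exec_Skip bounded_storeD(1)[of B s] by (simp add: Suc_le_eq)
  then show ?case using exec_Skip by (auto simp: bind_return_pmf)
next
  case (exec_Assign e s x)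
  have B: "1 \<le> B" by (rule bounded_storeD(1)[OF exec_Assign(2)])
  have "acost e s + blen (aval e s) \<le> 3 * (expr_weight e * B)\<^sup>2 + B"
    using acost_le[OF exec_Assign(2), of e] exec_Assign(1) by simp
  also have "\<dots> \<le> 4 * (expr_weight e)\<^sup>2 * B\<^sup>2" by (rule blen_sq_bound[OF expr_weight_pos B])
  also have "\<dots> \<le> W * B\<^sup>2" using exec_Assign(3) by simp
  finally show ?case using exec_Assign(1,2)
    by (auto simp: bind_return_pmf bounded_store_def set_reg_def)
next
  case (exec_Write e2 s A e1)
  have B: "1 \<le> B" by (rule bounded_storeD(1)[OF exec_Write(2)])
  define u where "u = expr_weight e1"
  define v where "v = expr_weight e2"
  have uv: "1 \<le> u" "1 \<le> v" unfolding u_def v_def by (rule expr_weight_pos)+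
  have "acost e1 s + acost e2 s + blen (aval e1 s) + blen (aval e2 s)
      \<le> 3 * (u * B)\<^sup>2 + 3 * (v * B)\<^sup>2 + u * B + B"
    using acost_le[OF exec_Write(2), of e1] acost_le[OF exec_Write(2), of e2]
      blen_aval[OF exec_Write(2), of e1] exec_Write(1) by (simp add: u_def v_def)
  also have "\<dots> \<le> 3 * ((u + v) * B)\<^sup>2 + B"
  proof -
    have "u * B \<le> (u * B) * (v * B)"
      using uv B by (simp add: Suc_le_eq)
    then show ?thesis by (simp add: power2_eq_square algebra_simps)
  qed
  also have "\<dots> \<le> 4 * (u + v)\<^sup>2 * B\<^sup>2" by (rule blen_sq_bound[OF _ B]) (use uv in simp)
  also have "\<dots> \<le> W * B\<^sup>2" using exec_Write(3) by (simp add: u_def v_def)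
  finally show ?case using exec_Write(1,2)
    by (auto simp: bind_return_pmf bounded_store_def set_arr_def)
next
  case (exec_Seq c1 s s1 k1 c2 s2 k2)
  have w: "com_weight c1 \<le> W" "com_weight c2 \<le> W" using exec_Seq.prems(2) by auto
  note IH1 = exec_Seq.IH(1)[OF exec_Seq.prems(1) w(1)]
  note IH2 = exec_Seq.IH(2)[OF conjunct1[OF IH1] w(2)]
  have c: "1 \<le> W * B\<^sup>2"
    using w(1) com_weight_pos[of c1] bounded_storeD(1)[OF exec_Seq.prems(1)] by (simp add: Suc_le_eq)
  have "\<exists>t'\<le>t + (1 + (k1 + k2)) * (W * B\<^sup>2).
      run (1 + (k1 + k2)) (Seq c1 c2 # K, s, t) = return_pmf (K, s2, t')" for K t
  proof -
    obtain t1 where t1: "t1 \<le> t + 1 + k1 * (W * B\<^sup>2)"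
      "run k1 (c1 # c2 # K, s, t + 1) = return_pmf (c2 # K, s1, t1)" using IH1 by blast
    obtain t2 where t2: "t2 \<le> t1 + k2 * (W * B\<^sup>2)"
      "run k2 (c2 # K, s1, t1) = return_pmf (K, s2, t2)" using IH2 by blast
    have "run (1 + (k1 + k2)) (Seq c1 c2 # K, s, t) = return_pmf (K, s2, t2)"
      using t1 t2 by (simp add: bind_return_pmf run_add)
    moreover have "t2 \<le> t + (1 + (k1 + k2)) * (W * B\<^sup>2)"
      unfolding add_mult_distrib using t1(1) t2(1) c by linarith
    ultimately show ?thesis by blast
  qed
  then show ?case using IH2 by blast
next
  case (exec_If e s c1 c2 s' k)
  have w: "com_weight (if aval e s \<noteq> 0 then c1 else c2) \<le> W" "3 * (expr_weight e)\<^sup>2 \<le> W"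
    using exec_If.prems(2) by auto
  note IH = exec_If.IH[OF exec_If.prems(1) w(1)]
  have c: "acost e s \<le> W * B\<^sup>2"
    using le_trans[OF acost_le[OF exec_If.prems(1), of e]] mult_le_mono1[OF w(2), of "B\<^sup>2"]
    by (simp only: power_mult_distrib mult.assoc)
  have "\<exists>t'\<le>t + (1 + k) * (W * B\<^sup>2). run (1 + k) (If e c1 c2 # K, s, t) = return_pmf (K, s', t')" for K t
  proof -
    obtain t1 where t1: "t1 \<le> t + acost e s + k * (W * B\<^sup>2)"
      "run k ((if aval e s \<noteq> 0 then c1 else c2) # K, s, t + acost e s) = return_pmf (K, s', t1)"
      using IH by blast
    have "run (1 + k) (If e c1 c2 # K, s, t) = return_pmf (K, s', t1)"
      using t1 by (simp add: bind_return_pmf)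
    moreover have "t1 \<le> t + (1 + k) * (W * B\<^sup>2)"
      unfolding add_mult_distrib using t1(1) c by linarith
    ultimately show ?thesis by blast
  qed
  then show ?case using IH by blast
next
  case (exec_While_end e s c)
  have w: "3 * (expr_weight e)\<^sup>2 \<le> W"
    using exec_While_end by auto
  have c: "acost e s \<le> W * B\<^sup>2"
    using le_trans[OF acost_le[OF exec_While_end(2), of e]] mult_le_mono1[OF w, of "B\<^sup>2"]
    by (simp only: power_mult_distrib mult.assoc)
  then show ?case using exec_While_end by (auto simp: bind_return_pmf)
next
  case (exec_While_step e s c s1 k1 s2 k2)
  have w: "com_weight c \<le> W" "3 * (expr_weight e)\<^sup>2 \<le> W" using exec_While_step.prems(2) by auto
  note IH1 = exec_While_step.IH(1)[OF exec_While_step.prems(1) w(1)]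
  note IH2 = exec_While_step.IH(2)[OF conjunct1[OF IH1] exec_While_step.prems(2)]
  have c: "acost e s \<le> W * B\<^sup>2"
    using le_trans[OF acost_le[OF exec_While_step.prems(1), of e]] mult_le_mono1[OF w(2), of "B\<^sup>2"]
    by (simp only: power_mult_distrib mult.assoc)
  have "\<exists>t'\<le>t + (1 + (k1 + k2)) * (W * B\<^sup>2).
      run (1 + (k1 + k2)) (While e c # K, s, t) = return_pmf (K, s2, t')" for K t
  proof -
    obtain t1 where t1: "t1 \<le> t + acost e s + k1 * (W * B\<^sup>2)"
      "run k1 (c # While e c # K, s, t + acost e s) = return_pmf (While e c # K, s1, t1)"
      using IH1 by blast
    obtain t2 where t2: "t2 \<le> t1 + k2 * (W * B\<^sup>2)"
      "run k2 (While e c # K, s1, t1) = return_pmf (K, s2, t2)" using IH2 by blast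
    have "run (1 + (k1 + k2)) (While e c # K, s, t) = return_pmf (K, s2, t2)"
      using t1 t2 exec_While_step.hyps by (simp add: bind_return_pmf run_add)
    moreover have "t2 \<le> t + (1 + (k1 + k2)) * (W * B\<^sup>2)"
      unfolding add_mult_distrib using t1(1) t2(1) c by linarith
    ultimately show ?thesis by blast
  qed
  then show ?case using IH2 by blast
qed

section \<open>Total correctness rules with step budgets\<close>

definition terminates :: "nat \<Rightarrow> com \<Rightarrow> store \<Rightarrow> nat \<Rightarrow> (store \<Rightarrow> bool) \<Rightarrow> bool" where
  "terminates B c s N Q \<longleftrightarrow> (\<exists>s' k. exec B c s s' k \<and> k \<le> N \<and> Q s')"

text \<open>The run is a point mass that is final after some \<open>k \<le> N\<close> steps; the
  remaining \<open>T - k\<close> steps change nothing.\<close>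

lemma terminates_halts:
  assumes "terminates B c s N Q" "bounded_store B s"
  defines "T \<equiv> N * (com_weight c * B\<^sup>2)"
  shows "halts_within c s T"
    "(\<And>s'. Q s' \<Longrightarrow> (regs s' 0, regs s' 1) \<in> S) \<Longrightarrow> measure_pmf.prob (output_after c s T) S = 1"
proof -
  obtain s' k where k: "exec B c s s' k" "k \<le> N" "Q s'" using assms by (auto simp: terminates_def)
  obtain t where t: "t \<le> k * (com_weight c * B\<^sup>2)" "run k ([c], s, 0) = return_pmf ([], s', t)"
    using exec_run[OF k(1) assms(2) order_refl] by (metis add_0)
  have "1 \<le> com_weight c * B\<^sup>2"
    using com_weight_pos[of c] bounded_storeD(1)[OF assms(2)] by (simp add: Suc_le_eq)
  then have "k \<le> T" using k(2) unfolding T_def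
    by (metis le_trans mult_le_mono nat_mult_1_right)
  then have run: "run T ([c], s, 0) = return_pmf ([], s', t)"
    using run_add[of k "T - k" "([c], s, 0)"] t(2) by (simp add: bind_return_pmf run_halted)
  have "t \<le> T" using t(1) k(2) unfolding T_def by (meson le_trans mult_le_mono1)
  then show "halts_within c s T" by (simp add: halts_within_def run)
  show "measure_pmf.prob (output_after c s T) S = 1"
    if "\<And>s'. Q s' \<Longrightarrow> (regs s' 0, regs s' 1) \<in> S"
    using that[OF k(3)] by (simp add: output_after_def run measure_return)
qed

lemma terminates_mono:
  "terminates B c s N Q \<Longrightarrow> N \<le> N' \<Longrightarrow> (\<And>s'. Q s' \<Longrightarrow> Q' s') \<Longrightarrow> terminates B c s N' Q'"
  by (fastforce simp: terminates_def)

lemma terminates_Skip: "Q s \<Longrightarrow> 1 \<le> N \<Longrightarrow> terminates B Skip s N Q"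
  using exec_Skip by (fastforce simp: terminates_def)

lemma terminates_Assign:
  "blen (aval e s) \<le> B \<Longrightarrow> Q (set_reg x (aval e s) s) \<Longrightarrow> 1 \<le> N \<Longrightarrow> terminates B (Assign x e) s N Q"
  using exec_Assign by (fastforce simp: terminates_def)

lemma terminates_Write:
  "blen (aval e2 s) \<le> B \<Longrightarrow> Q (set_arr A (aval e1 s) (aval e2 s) s) \<Longrightarrow> 1 \<le> N \<Longrightarrow>
    terminates B (Write A e1 e2) s N Q"
  using exec_Write by (fastforce simp: terminates_def)

text \<open>The postcondition of \<open>c1\<close> is itself a \<open>terminates\<close> statement
  about \<open>c2\<close>. Correctness and step budget are thus derived together along the program
  text, as with weakest preconditions.\<close>

lemma terminates_Seq:
  assumes "terminates B c1 s N1 (\<lambda>s'. terminates B c2 s' N2 Q)" "1 + (N1 + N2) \<le> N"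
  shows "terminates B (Seq c1 c2) s N Q"
proof -
  obtain s1 s2 k1 k2 where "exec B c1 s s1 k1" "exec B c2 s1 s2 k2" "k1 \<le> N1" "k2 \<le> N2" "Q s2"
    using assms(1) by (auto simp: terminates_def)
  then show ?thesis using exec_Seq[of B c1 s s1 k1 c2 s2 k2] assms(2)
    by (fastforce simp: terminates_def)
qed

lemma terminates_If:
  assumes "aval e s \<noteq> 0 \<Longrightarrow> terminates B c1 s N1 Q" "aval e s = 0 \<Longrightarrow> terminates B c2 s N1 Q"
    "1 + N1 \<le> N"
  shows "terminates B (If e c1 c2) s N Q"
proof -
  obtain s' k where "exec B (if aval e s \<noteq> 0 then c1 else c2) s s' k" "k \<le> N1" "Q s'"
    using assms(1,2) by (cases "aval e s = 0") (auto simp: terminates_def)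
  then show ?thesis using exec_If[of B e s c1 c2 s' k] assms(3)
    by (fastforce simp: terminates_def)
qed

lemma regs_set_reg [simp]: "regs (set_reg x v s) y = (if y = x then v else regs s y)"
  and arrs_set_reg [simp]: "arrs (set_reg x v s) = arrs s"
  and regs_set_arr [simp]: "regs (set_arr A i v s) = regs s"
  and arrs_set_arr [simp]:
    "arrs (set_arr A i v s) A' i' = (if A' = A \<and> i' = i then v else arrs s A' i')"
  by (auto simp: set_reg_def set_arr_def)

definition For :: "nat \<Rightarrow> nat \<Rightarrow> com \<Rightarrow> com" where
  "For x b c = Seq (Assign x (Const 0))
     (While (Op Less (Reg x) (Reg b)) (Seq c (Assign x (Op Add (Reg x) (Const 1)))))"

text \<open>Each pass adds 3 steps to the body: guard, \<open>Seq\<close> and increment. The final 3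
  are the outer \<open>Seq\<close>, the initial assignment and the failing guard. The invariant is
  demanded after the increment of \<open>x\<close>.\<close>

lemma terminates_For:
  assumes init: "I 0 (set_reg x 0 s)" "regs s b = M" "x \<noteq> b" "blen M \<le> B"
    and body: "\<And>i s. i < M \<Longrightarrow> I i s \<Longrightarrow> regs s x = i \<Longrightarrow> regs s b = M \<Longrightarrow>
      terminates B c s N (\<lambda>s'. regs s' x = i \<and> regs s' b = M \<and> I (Suc i) (set_reg x (Suc i) s'))"
    and final: "\<And>s. I M s \<Longrightarrow> regs s b = M \<Longrightarrow> Q s"
    and cost: "M * (N + 3) + 3 \<le> T"
  shows "terminates B (For x b c) s T Q"
proof -
  let ?W = "While (Op Less (Reg x) (Reg b)) (Seq c (Assign x (Op Add (Reg x) (Const 1))))"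
  \<comment> \<open>Induction on the number \<open>j\<close> of passes still to come, as the counter
    runs upwards to \<open>M\<close>.\<close>
  have loop: "terminates B ?W s (j * (N + 3) + 1) Q"
    if "I (M - j) s" "j \<le> M" "regs s x = M - j" "regs s b = M" for j s
    using that
  proof (induction j arbitrary: s)
    case 0
    have "exec B ?W s s 1" by (rule exec_While_end) (use 0 in simp)
    then show ?case using final[of s] 0 by (auto simp: terminates_def)
  next
    case (Suc j)
    let ?i = "M - Suc j"
    have i: "?i < M" "Suc ?i = M - j" using Suc.prems(2) by auto
    obtain s1 k1 where s1: "exec B c s s1 k1" "k1 \<le> N" "regs s1 x = ?i" "regs s1 b = M"
      "I (Suc ?i) (set_reg x (Suc ?i) s1)"
      using body[OF i(1) Suc.prems(1,3,4)] by (auto simp: terminates_def)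
    have "blen (Suc ?i) \<le> B" using init(4) blen_mono[of "Suc ?i" M] i by linarith
    then have as: "exec B (Assign x (Op Add (Reg x) (Const 1))) s1 (set_reg x (Suc ?i) s1) 1"
      using exec_Assign[of "Op Add (Reg x) (Const 1)" s1 B x] s1(3) by simp
    obtain s2 k2 where s2: "exec B ?W (set_reg x (Suc ?i) s1) s2 k2" "k2 \<le> j * (N + 3) + 1" "Q s2"
      using Suc.IH[of "set_reg x (Suc ?i) s1"] s1(4,5) init(3) i Suc.prems(2)
      by (auto simp: terminates_def)
    have "exec B ?W s s2 (1 + (1 + (k1 + 1) + k2))"
      by (rule exec_While_step[OF _ exec_Seq[OF s1(1) as] s2(1)]) (use Suc.prems i in simp)
    then show ?case using s2(2,3) s1(2) by (fastforce simp: terminates_def)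
  qed
  have "terminates B ?W (set_reg x 0 s) (M * (N + 3) + 1) Q"
    using loop[of M "set_reg x 0 s"] init by simp
  moreover have "blen 0 \<le> B"
    using init(4) blen_mono[of 0 M] by linarith
  ultimately show ?thesis unfolding For_def
    by (intro terminates_Seq[where ?N1.0 = 1] terminates_Assign) (use cost in auto)
qed

section \<open>Hamming distance\<close>

lemma hdist_commute: "length u = length v \<Longrightarrow> hdist u v = hdist v u"
  unfolding hdist_def by (rule arg_cong[of _ _ card]) auto

lemma hdist_triangle:
  assumes "length u = length v" "length v = length w"
  shows "hdist u w \<le> hdist u v + hdist v w"
proof -
  have "hdist u w \<le> card ({k. k < length u \<and> u ! k \<noteq> v ! k} \<union> {k. k < length v \<and> v ! k \<noteq> w ! k})"
    unfolding hdist_def using assms by (intro card_mono) auto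
  also have "\<dots> \<le> hdist u v + hdist v w"
    unfolding hdist_def by (rule card_Un_le)
  finally show ?thesis .
qed

lemma hdist_le_length: "hdist u v \<le> length u"
proof -
  have "hdist u v \<le> card {..<length u}"
    unfolding hdist_def by (intro card_mono) auto
  then show ?thesis by simp
qed

lemma hdist_sum: "hdist u v = (\<Sum>k<length u. of_bool (u ! k \<noteq> v ! k))"
proof -
  have "{k. k < length u \<and> u ! k \<noteq> v ! k} = {k \<in> {..<length u}. u ! k \<noteq> v ! k}" by auto
  then show ?thesis unfolding hdist_def by (simp add: sum.If_cases Int_def of_bool_def)
qed

lemma hdist_snoc:
  assumes "length v = k" "k < length x"
  shows "hdist (v @ [c]) (take (Suc k) x) = hdist v (take k x) + of_bool (c \<noteq> x ! k)"
proof -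
  have "hdist (v @ [c]) (take (Suc k) x) =
      (\<Sum>i<k. of_bool ((v @ [c]) ! i \<noteq> take (Suc k) x ! i)) + of_bool (c \<noteq> x ! k)"
    unfolding hdist_sum using assms by (simp add: nth_append)
  also have "(\<Sum>i<k. of_bool ((v @ [c]) ! i \<noteq> take (Suc k) x ! i)) = hdist v (take k x)"
    unfolding hdist_sum using assms by (intro sum.cong) (auto simp: nth_append)
  finally show ?thesis .
qed

text \<open>Among the coordinates where \<open>x\<close> and \<open>y\<close> differ,
  \<open>f\<close> are switched from \<open>x\<close> to \<open>y\<close>.\<close>

lemma hdist_midpoint:
  assumes "length x = m" "length y = m" "f \<le> hdist x y"
  obtains v where "length v = m" "hdist v x = f" "hdist v y = hdist x y - f"
proof -
  let ?D = "{k. k < length x \<and> x ! k \<noteq> y ! k}"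
  obtain F where F: "F \<subseteq> ?D" "card F = f"
    using assms(3) obtain_subset_with_card_n[of f ?D] unfolding hdist_def by blast
  define v where "v = map (\<lambda>k. if k \<in> F then y ! k else x ! k) [0..<m]"
  have len: "length v = m" by (simp add: v_def)
  have "{k. k < length v \<and> v ! k \<noteq> x ! k} = F"
    using F(1) assms len by (auto simp: v_def)
  moreover have "{k. k < length v \<and> v ! k \<noteq> y ! k} = ?D - F"
    using F(1) assms len by (auto simp: v_def split: if_splits)
  ultimately have "hdist v x = f" "hdist v y = card (?D - F)"
    using F(2) by (simp_all add: hdist_def)
  moreover have "card (?D - F) = hdist x y - f"
    using F by (simp add: card_Diff_subset finite_subset[OF F(1)] hdist_def)
  ultimately show ?thesis using that len by simp
qed

section \<open>The Plotkin bound\<close>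

text \<open>If \<open>c\<close> indices satisfy \<open>p\<close> and \<open>e\<close> do not, the
  double sum is \<open>2 * c * e\<close>, and \<open>4 * c * e\<close> is at most the square of
  \<open>c + e\<close>.\<close>

lemma sum_indicator_differ:
  fixes p :: "'a \<Rightarrow> bool"
  assumes "finite G"
  shows "2 * (\<Sum>i\<in>G. \<Sum>j\<in>G. of_bool (p i \<noteq> p j) :: nat) \<le> (card G)\<^sup>2"
proof -
  define A where "A = {i \<in> G. p i}"
  define c where "c = card A"
  define e where "e = card (G - A)"
  have fin: "finite A" "A \<subseteq> G" using assms by (auto simp: A_def)
  have card: "card G = c + e"
    unfolding c_def e_def using fin assms by (metis card_Diff_subset card_mono le_add_diff_inverse)
  have inner: "(\<Sum>j\<in>G. of_bool (p i \<noteq> p j) :: nat) = (if p i then e else c)" for i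
  proof -
    have "(\<Sum>j\<in>G. of_bool (p i \<noteq> p j) :: nat) = card {j \<in> G. p i \<noteq> p j}"
      using assms by (simp add: of_bool_def sum.If_cases Int_def)
    also have "{j \<in> G. p i \<noteq> p j} = (if p i then G - A else A)" by (auto simp: A_def)
    finally show ?thesis by (simp add: c_def e_def)
  qed
  have "(\<Sum>i\<in>G. if p i then e else c) = c * e + e * c"
  proof -
    have "(\<Sum>i\<in>G. if p i then e else c) = (\<Sum>i\<in>G - A. c) + (\<Sum>i\<in>A. e)"
      unfolding sum.subset_diff[OF fin(2) assms]
      by (intro arg_cong2[of _ _ _ _ "(+)"] sum.cong) (auto simp: A_def)
    then show ?thesis by (simp add: c_def e_def)
  qed
  then have "2 * (\<Sum>i\<in>G. \<Sum>j\<in>G. of_bool (p i \<noteq> p j) :: nat) = 4 * (c * e)"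
    unfolding inner by simp
  also have "\<dots> \<le> (c + e)\<^sup>2"
  proof -
    have "0 \<le> (int c - int e)\<^sup>2" by simp
    then have "int (4 * (c * e)) \<le> int ((c + e)\<^sup>2)"
      by (simp add: power2_eq_square algebra_simps)
    then show ?thesis by (simp only: of_nat_le_iff)
  qed
  finally show ?thesis by (simp add: card)
qed

text \<open>Double counting of distances: the ordered pairs of \<open>M\<close> words contribute at
  least \<open>M * (M - 1) * d\<close>, whereas each of the \<open>2 * d - 1\<close> coordinates
  contributes at most half of \<open>M * M\<close>.\<close>

lemma plotkin_bound_short:
  assumes fin: "finite G" and d: "1 \<le> d"
    and len: "\<And>i. i \<in> G \<Longrightarrow> length (c i) = 2 * d - 1"
    and dist: "\<And>i j. i \<in> G \<Longrightarrow> j \<in> G \<Longrightarrow> i \<noteq> j \<Longrightarrow> d \<le> hdist (c i) (c j)"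
  shows "card G \<le> 2 * d"
proof (cases "G = {}")
  case False
  define M where "M = card G"
  have M: "1 \<le> M" using False fin by (simp add: M_def Suc_le_eq card_gt_0_iff)
  have "M * ((M - 1) * d) = (\<Sum>i\<in>G. \<Sum>j\<in>G - {i}. d)"
    using fin by (simp add: M_def)
  also have "\<dots> \<le> (\<Sum>i\<in>G. \<Sum>j\<in>G - {i}. hdist (c i) (c j))"
    using dist by (intro sum_mono) auto
  also have "\<dots> \<le> (\<Sum>i\<in>G. \<Sum>j\<in>G. hdist (c i) (c j))"
    using fin by (intro sum_mono sum_mono2) auto
  also have "\<dots> = (\<Sum>i\<in>G. \<Sum>j\<in>G. \<Sum>k<2 * d - 1. of_bool (c i ! k \<noteq> c j ! k))"
    using len by (simp add: hdist_sum)
  also have "\<dots> = (\<Sum>k<2 * d - 1. \<Sum>i\<in>G. \<Sum>j\<in>G. of_bool (c i ! k \<noteq> c j ! k))"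
    by (subst (2) sum.swap, subst sum.swap) simp
  finally have "2 * (M * ((M - 1) * d)) \<le>
      (\<Sum>k<2 * d - 1. 2 * (\<Sum>i\<in>G. \<Sum>j\<in>G. of_bool (c i ! k \<noteq> c j ! k)))"
    by (simp add: sum_distrib_left[symmetric])
  also have "\<dots> \<le> (\<Sum>k<2 * d - 1. M\<^sup>2)"
    unfolding M_def by (intro sum_mono sum_indicator_differ fin)
  finally have "M * (2 * (M - 1) * d) \<le> M * ((2 * d - 1) * M)"
    by (simp add: power2_eq_square algebra_simps)
  then have "2 * (M - 1) * d \<le> (2 * d - 1) * M" using M by simp
  moreover obtain M' d' where "M = Suc M'" "d = Suc d'" using M d by (metis Suc_le_D One_nat_def)
  ultimately have "M \<le> 2 * d" by (simp add: algebra_simps)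
  then show ?thesis by (simp add: M_def)
qed simp

text \<open>The words are grouped by their prefix of length \<open>m + 1 - 2 * d\<close>. Within a
  group all differences lie in the last \<open>2 * d - 1\<close> coordinates, where
  \<open>plotkin_bound_short\<close> applies.\<close>

lemma plotkin_bound:
  assumes d: "1 \<le> d" "2 * d \<le> m"
    and len: "\<And>i. i < n \<Longrightarrow> length (c i) = m"
    and dist: "\<And>i j. i < n \<Longrightarrow> j < n \<Longrightarrow> i \<noteq> j \<Longrightarrow> d \<le> hdist (c i) (c j)"
  shows "n \<le> 2 ^ (m + 1 - 2 * d) * (2 * d)"
proof -
  define l where "l = m + 1 - 2 * d"
  define W where "W = {w :: bool list. length w = l}"
  have W: "finite W" "card W = 2 ^ l"
    using finite_lists_length_eq[of "UNIV :: bool set" l] card_lists_length_eq[of "UNIV :: bool set" l]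
    by (simp_all add: W_def)
  define G where "G w = {i. i < n \<and> take l (c i) = w}" for w
  have l: "l \<le> m" "m - l = 2 * d - 1" using d by (auto simp: l_def)
  have G: "card (G w) \<le> 2 * d" for w
  proof (rule plotkin_bound_short[OF _ d(1), of _ "\<lambda>i. drop l (c i)"])
    show "finite (G w)" by (simp add: G_def)
    show "length (drop l (c i)) = 2 * d - 1" if "i \<in> G w" for i
      using that len l by (simp add: G_def)
    show "d \<le> hdist (drop l (c i)) (drop l (c j))" if ij: "i \<in> G w" "j \<in> G w" "i \<noteq> j" for i j
    proof -
      have lens: "length (c i) = m" "length (c j) = m" using len ij by (auto simp: G_def)
      have eq: "c i ! k = c j ! k" if "k < l" for k
        using ij(1,2) that nth_take[OF that, of "c i"] nth_take[OF that, of "c j"] by (simp add: G_def)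
      have "{k. k < length (c i) \<and> c i ! k \<noteq> c j ! k} =
          (\<lambda>k. k + l) ` {k. k < length (drop l (c i)) \<and> drop l (c i) ! k \<noteq> drop l (c j) ! k}"
        (is "?L = ?R")
      proof (intro equalityI subsetI)
        fix k assume k: "k \<in> ?L"
        then have "l \<le> k" using eq not_less by blast
        then have "k = (k - l) + l" "k - l < m - l" using k lens by auto
        then show "k \<in> ?R" using k lens l(1) by (intro image_eqI[of _ _ "k - l"]) auto
      next
        fix k assume "k \<in> ?R"
        then show "k \<in> ?L" using lens l(1) by (auto simp: add.commute)
      qed
      then have "hdist (c i) (c j) = hdist (drop l (c i)) (drop l (c j))"
        unfolding hdist_def by (simp add: card_image)
      then show ?thesis using dist[of i j] ij by (simp add: G_def)
    qed
  qed
  have "{..<n} \<subseteq> (\<Union>w\<in>W. G w)" using len l by (auto simp: W_def G_def)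
  then have "n \<le> card (\<Union>w\<in>W. G w)"
    using W(1) card_mono[of "\<Union>w\<in>W. G w" "{..<n}"] by (simp add: G_def)
  also have "\<dots> \<le> (\<Sum>w\<in>W. card (G w))" by (rule card_UN_le[OF W(1)])
  also have "\<dots> \<le> (\<Sum>w\<in>W. 2 * d)" by (intro sum_mono G)
  finally show ?thesis using W by (simp add: l_def)
qed

section \<open>Entropy and the Zyablov rate\<close>

lemma H2_strict_mono:
  assumes "0 < x" "x < y" "y \<le> 1/2"
  shows "H2 x < H2 y"
proof (rule DERIV_pos_imp_increasing_open[OF assms(2)])
  fix z assume z: "x < z" "z < y"
  have H2: "H2 = (\<lambda>z. (- (z * ln z) - (1 - z) * ln (1 - z)) / ln 2)"
    by (rule ext) (simp add: H2_def log_def diff_divide_distrib)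
  have "(H2 has_real_derivative (- (ln z + 1) + (ln (1 - z) + 1)) / ln 2) (at z)"
    unfolding H2 using z assms by (auto intro!: derivative_eq_intros)
  moreover have "0 < (- (ln z + 1) + (ln (1 - z) + 1)) / ln 2" using z assms by simp
  ultimately show "\<exists>D. (H2 has_real_derivative D) (at z) \<and> 0 < D" by blast
next
  show "continuous_on {x..y} H2"
    unfolding H2_def log_def using assms by (intro continuous_intros) auto
qed

lemma H2_0: "H2 0 = 0" and H2_half: "H2 (1/2) = 1"
  by (simp_all add: H2_def log_divide)

lemma H2_pos: assumes "0 < x" "x \<le> 1/2" shows "0 < H2 x"
proof -
  have "x * log 2 x < 0" "(1 - x) * log 2 (1 - x) < 0" using assms by (auto intro!: mult_pos_neg)
  then show ?thesis by (simp add: H2_def)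
qed

lemma H2_less_1: assumes "0 \<le> x" "x < 1/2" shows "H2 x < 1"
  using assms H2_strict_mono[of x "1/2"] H2_half H2_0 by (cases "x = 0") auto

lemma H2_le_1: assumes "0 \<le> x" "x \<le> 1/2" shows "H2 x \<le> 1"
proof (cases "x = 1/2")
  case True
  show ?thesis unfolding True H2_half ..
qed (use assms H2_less_1[of x] in simp)

text \<open>The intermediate value theorem gives a preimage of \<open>h\<close> in
  \<open>{\<delta>..1/2}\<close>; injectivity on \<open>{0..1/2}\<close> identifies it with the
  value of \<open>the_inv_into\<close>.\<close>

lemma H2_inv_pos:
  assumes "0 < \<delta>" "\<delta> \<le> 1/2" "H2 \<delta> \<le> h" "h \<le> 1"
  shows "0 < H2_inv h"
proof -
  have "continuous_on {\<delta>..1/2} H2"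
    unfolding H2_def log_def using assms by (intro continuous_intros) auto
  then obtain y where y: "\<delta> \<le> y" "y \<le> 1/2" "H2 y = h"
    using IVT'[of H2 \<delta> h "1/2"] assms H2_half by auto
  have "inj_on H2 {0..1/2}"
  proof (rule linorder_inj_onI)
    fix u v :: real assume uv: "u < v" "u \<in> {0..1/2}" "v \<in> {0..1/2}"
    show "H2 u \<noteq> H2 v"
      using H2_strict_mono[of u v] H2_pos[of v] H2_0 uv by (cases "u = 0") auto
  qed auto
  then have "H2_inv h = y"
    unfolding H2_inv_def using the_inv_into_f_f[of H2 "{0..1/2}" y] y assms by auto
  then show ?thesis using y assms by simp
qed

lemma zyablov_le:
  assumes "0 \<le> \<delta>" "\<delta> \<le> 1/2"
  shows "zyablov \<delta> \<le> 1 - H2 \<delta>"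
proof (cases "\<delta> < 1/2")
  case True
  have "r * (1 - \<delta> / H2_inv (1 - r)) \<le> 1 - H2 \<delta>" if r: "r \<in> {0<..<1 - H2 \<delta>}" for r
  proof -
    \<comment> \<open>At \<open>\<delta> = 0\<close> the quotient is 0 whatever the denominator;
      otherwise the denominator is positive.\<close>
    have "0 \<le> \<delta> / H2_inv (1 - r)"
      using H2_inv_pos[of \<delta> "1 - r"] assms r by (cases "\<delta> = 0") auto
    then have "r * (1 - \<delta> / H2_inv (1 - r)) \<le> r * 1" using r by (intro mult_left_mono) auto
    also have "\<dots> \<le> 1 - H2 \<delta>" using r by simp
    finally show ?thesis .
  qed
  \<comment> \<open>\<open>cSUP_least\<close> asks for a nonempty interval, which
    \<open>H2_less_1\<close> provides.\<close>
  then show ?thesis using True H2_less_1[of \<delta>] assms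
    by (simp add: zyablov_def) (intro cSUP_least, auto)
next
  case False
  then have "\<delta> = 1/2" using assms by simp
  then show ?thesis by (simp only: zyablov_def H2_half) simp
qed

text \<open>At \<open>3/13\<close> this reads \<open>3 ^ 3 * 10 ^ 10 * 2 ^ 10 \<le> 13 ^ 13\<close>.\<close>

lemma H2_ge:
  assumes "3/13 \<le> p" "p \<le> 1/2"
  shows "1 - p \<le> H2 p"
proof -
  have "3 * log 2 3 + 10 * log 2 10 + 10 = log 2 ((3 ^ 3 * 10 ^ 10) * 2 ^ 10 :: real)"
    by (simp only: log_mult log_nat_power) simp
  also have "\<dots> \<le> log 2 (13 ^ 13)" by simp
  also have "\<dots> = 13 * log 2 13" by (simp only: log_nat_power)
  finally have "10 / 13 \<le> log 2 13 - 3/13 * log 2 3 - 10/13 * log 2 (10::real)" by simp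
  also have "\<dots> = H2 (3/13)"
    by (simp add: H2_def log_divide algebra_simps)
  finally have "10 / 13 \<le> H2 (3/13)" .
  moreover have "H2 (3/13) \<le> H2 p"
  proof (cases "p = 3/13")
    case True
    show ?thesis unfolding True ..
  qed (use H2_strict_mono[of "3/13" p] assms in simp)
  ultimately show ?thesis using assms by linarith
qed

section \<open>Chernoff weights for Hamming balls\<close>

lemma ball_exponent:
  fixes p :: real
  assumes "0 < p" "p \<le> 3/13" "0 < m"
  defines "x \<equiv> p / (1 - p)"
  shows "(2 * x\<^sup>2) powr - (p * m / 2) * (1 + 2 * x\<^sup>2) powr m \<le> 2 powr ((H2 p - p) * m)"
proof -
  have x: "0 < x" "x \<le> 3/10" using assms by (auto simp: x_def field_simps)
  have px: "1 - p = 1 / (1 + x)" "p = x / (1 + x)" using assms by (auto simp: x_def field_simps)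
  \<comment> \<open>In terms of \<open>x\<close> the entropy is
    \<open>log 2 (1 + x) - p * log 2 x\<close>. After cancelling \<open>p * log 2 x\<close> the
    claim reduces to the logarithm of this inequality.\<close>
  have step: "1 + 2 * x\<^sup>2 \<le> (1 + x) * 2 powr - (p / 2)"
  proof -
    \<comment> \<open>From \<open>x \<le> 3/10\<close> follows
      \<open>2 * x * x \<le> 65/100 * x\<close>. The remaining \<open>35/100\<close> exceeds
      \<open>ln 2 / 2\<close>, by the bound \<open>25/36\<close> on \<open>ln 2\<close>.\<close>
    have "1 + 2 * x\<^sup>2 \<le> (1 + x) - 35/100 * x" using x by (simp add: power2_eq_square)
    also have "\<dots> = (1 + x) * (1 - 35/100 * p)" using x by (simp add: px(2) field_simps)
    also have "\<dots> \<le> (1 + x) * (1 + - (p/2) * ln 2)"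
      using x assms ln2_le_25_over_36 by (intro mult_left_mono) (auto simp: field_simps)
    also have "\<dots> \<le> (1 + x) * 2 powr - (p / 2)"
      using x exp_ge_add_one_self[of "- (p/2) * ln 2"] by (intro mult_left_mono) (auto simp: powr_def)
    finally show ?thesis .
  qed
  have "log 2 (1 + 2 * x\<^sup>2) \<le> log 2 ((1 + x) * 2 powr - (p / 2))"
    using step x by (intro log_le_cancel_iff[THEN iffD2]) (auto intro: add_pos_nonneg)
  also have "\<dots> = log 2 (1 + x) - p / 2" using x by (simp add: log_mult)
  finally have l: "log 2 (1 + 2 * x\<^sup>2) \<le> log 2 (1 + x) - p / 2" .
  have h: "H2 p = log 2 (1 + x) - p * log 2 x"
  proof -
    have "log 2 p = log 2 x - log 2 (1 + x)" "log 2 (1 - p) = - log 2 (1 + x)"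
      unfolding px(1) using x by (simp_all add: px(2) log_divide)
    then show ?thesis unfolding H2_def by (simp only:) (simp add: algebra_simps)
  qed
  have powr: "u powr v = 2 powr (log 2 u * v)" if "0 < u" for u v :: real
    using that by (simp add: powr_def log_def)
  have "0 < 2 * x\<^sup>2" "0 < 1 + 2 * x\<^sup>2" using x by (simp_all add: add_pos_nonneg)
  then have "(2 * x\<^sup>2) powr - (p * m / 2) * (1 + 2 * x\<^sup>2) powr m =
      2 powr (log 2 (2 * x\<^sup>2) * - (p * m / 2)) * 2 powr (log 2 (1 + 2 * x\<^sup>2) * m)"
    by (simp only: powr[of "2 * x\<^sup>2"] powr[of "1 + 2 * x\<^sup>2"])
  also have "\<dots> = 2 powr ((log 2 (1 + 2 * x\<^sup>2) - p / 2 * log 2 (2 * x\<^sup>2)) * m)"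
    by (simp add: powr_add[symmetric] algebra_simps)
  also have "\<dots> \<le> 2 powr ((H2 p - p) * m)"
  proof -
    have "log 2 (2 * x\<^sup>2) = 1 + 2 * log 2 x" using x by (simp add: log_mult log_nat_power)
    then have "log 2 (1 + 2 * x\<^sup>2) - p / 2 * log 2 (2 * x\<^sup>2) \<le> H2 p - p"
      using l h by (simp add: algebra_simps)
    then show ?thesis using assms by (intro powr_mono mult_right_mono) auto
  qed
  finally show ?thesis .
qed

text \<open>Let a word at distance \<open>w\<close> from a centre weigh \<open>y ^ w\<close>. All
  words weigh \<open>(1 + y) ^ m\<close> together, and since \<open>y \<le> 1\<close> each word in
  the ball of radius \<open>d - d div 2\<close> weighs at least \<open>y ^ (d - d div 2)\<close>;
  the quotient bounds the size of the ball.\<close>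

lemma ball_weight:
  assumes "1 \<le> m" "2 * d \<le> m" "13 * d \<le> 3 * m"
  obtains y :: real where "0 < y" "y \<le> 1"
    "(1 + y) ^ m \<le> 3 * real m * 2 powr ((H2 (d / m) - d / m) * m) * y ^ (d - d div 2)"
proof (cases "d = 0")
  case True
  \<comment> \<open>The general formula would give weight 0 here. The choice \<open>1 / m\<close>
    replaces it and is the source of the constant 3.\<close>
  have "(1 + 1 / real m) ^ m \<le> exp (1 / m) ^ m" by (intro power_mono) auto
  also have "\<dots> = exp 1" using assms by (simp add: exp_of_nat_mult[symmetric])
  also have "\<dots> \<le> 3" by (rule exp_le)
  also have "\<dots> \<le> 3 * real m" using assms by simp
  finally show ?thesis using True assms by (intro that[of "1 / m"]) (auto simp: H2_0)
next
  case False
  define p where "p = real d / real m"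
  define x where "x = p / (1 - p)"
  define y where "y = 2 * x\<^sup>2"
  define e where "e = d - d div 2"
  have m: "0 < real m" using assms by simp
  have p: "0 < p" "p \<le> 3/13" using False assms by (auto simp: p_def field_simps)
  have x: "0 < x" "x \<le> 3/10" using p by (auto simp: x_def field_simps)
  have "x\<^sup>2 \<le> (3/10)\<^sup>2" using x by (intro power_mono) auto
  then have y: "0 < y" "y \<le> 1" using x by (auto simp: y_def power2_eq_square)
  have e: "real e \<le> p * m / 2 + 1/2" using m by (simp add: e_def p_def)
  \<comment> \<open>Rounding \<open>d / 2\<close> up costs at most a factor
    \<open>1 / sqrt y\<close>. It is at most \<open>m\<close>, because \<open>d\<close> is at least
    1.\<close>
  have "1 / real m \<le> x"
  proof -
    have "1 / real m \<le> p" using False m by (simp add: p_def field_simps)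
    also have "p \<le> x" using p by (simp add: x_def field_simps)
    finally show ?thesis .
  qed
  also have "x \<le> sqrt y" using x by (simp add: y_def real_sqrt_mult)
  finally have s: "1 \<le> real m * sqrt y" using m by (simp add: field_simps)
  have "(1 + y) ^ m = y powr (p * m / 2) * (y powr - (p * m / 2) * (1 + y) powr m)"
    using y m by (simp add: powr_realpow powr_minus field_simps)
  also have "\<dots> \<le> y powr (p * m / 2) * 2 powr ((H2 p - p) * m)"
    unfolding y_def x_def by (intro mult_left_mono ball_exponent p m) auto
  also have "\<dots> \<le> y powr (p * m / 2) * (2 powr ((H2 p - p) * m) * (real m * sqrt y))"
    using s by (intro mult_left_mono) auto
  also have "\<dots> = real m * 2 powr ((H2 p - p) * m) * y powr (p * m / 2 + 1/2)"
    using y by (simp add: powr_add powr_half_sqrt)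
  also have "\<dots> \<le> real m * 2 powr ((H2 p - p) * m) * y powr real e"
    using e y by (intro mult_left_mono powr_mono') auto
  also have "\<dots> \<le> 3 * (real m * 2 powr ((H2 p - p) * m) * y powr real e)" by simp
  also have "\<dots> = 3 * real m * 2 powr ((H2 p - p) * m) * y ^ e"
    using y by (simp add: powr_realpow)
  finally show ?thesis using y that[of y] by (simp add: p_def e_def)
qed

section \<open>The algorithm\<close>

text \<open>Registers 3 and 4 hold the two indices, 5 the coordinate, 6 the distance so far, 7 and 8
  the answer. Subtraction from 1 negates a truth value and \<open>Mul\<close> is
  conjunction.\<close>

definition brute_force :: com where
  "brute_force =
     For 3 0 (For 4 0
       (Seq (Assign 6 (Const 0))
       (Seq (For 5 1 (Assign 6 (Op Add (Reg 6) (Op Sub (Const 1)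
               (Op Eq (Read 0 (Op Add (Op Mul (Reg 3) (Reg 1)) (Reg 5)))
                      (Read 0 (Op Add (Op Mul (Reg 4) (Reg 1)) (Reg 5))))))))
         (If (Op Mul (Op Less (Reg 3) (Reg 4)) (Op Eq (Reg 6) (Reg 2)))
           (Seq (Assign 7 (Reg 3)) (Assign 8 (Reg 4))) Skip))))"

section \<open>Problem instances and the comparison of all pairs\<close>

locale closest_pair_instance =
  fixes n m d a b :: nat and xs :: "bool list list" and B :: nat
  assumes two_le_n: "2 \<le> n" and one_le_m: "1 \<le> m"
    and length_xs: "length xs = n" and length_vectors: "\<forall>v \<in> set xs. length v = m"
    and closest: "unique_closest_pair xs a b" and d_def: "d = min_dist xs"
    and blen_n: "blen n \<le> B" and blen_m: "blen m \<le> B"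
begin

lemma length_nth: "i < n \<Longrightarrow> length (xs ! i) = m"
  using length_vectors length_xs by simp

lemma pair: "a < b" "b < n" "hdist (xs ! a) (xs ! b) = d"
proof -
  have "(a, b) \<in> {(i, j) \<in> index_pairs xs. hdist (xs ! i) (xs ! j) = min_dist xs}"
    using closest unfolding unique_closest_pair_def by simp
  then show "a < b" "b < n" "hdist (xs ! a) (xs ! b) = d"
    using length_xs by (auto simp: index_pairs_def d_def)
qed

lemma pair_unique: "i < j \<Longrightarrow> j < n \<Longrightarrow> hdist (xs ! i) (xs ! j) = d \<longleftrightarrow> i = a \<and> j = b"
proof -
  assume "i < j" "j < n"
  then have "hdist (xs ! i) (xs ! j) = d \<longleftrightarrow>
      (i, j) \<in> {(i, j) \<in> index_pairs xs. hdist (xs ! i) (xs ! j) = min_dist xs}"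
    using length_xs by (simp add: index_pairs_def d_def)
  then show ?thesis using closest unfolding unique_closest_pair_def by simp
qed

lemma d_le_hdist: "i < n \<Longrightarrow> j < n \<Longrightarrow> i \<noteq> j \<Longrightarrow> d \<le> hdist (xs ! i) (xs ! j)"
proof (induction i j rule: linorder_wlog)
  case (le i j)
  have "index_pairs xs \<subseteq> {..<n} \<times> {..<n}" using length_xs by (auto simp: index_pairs_def)
  then have "finite (index_pairs xs)" by (rule finite_subset) simp
  moreover have "(i, j) \<in> index_pairs xs" using le length_xs by (auto simp: index_pairs_def)
  ultimately show ?case unfolding d_def min_dist_def by (intro Min_le) force+
next
  case (sym i j)
  then show ?case using hdist_commute[of "xs ! i" "xs ! j"] length_nth by simp
qed

lemma close_pair:
  assumes "i < n" "j < n" "i \<noteq> j" "hdist (xs ! i) (xs ! j) \<le> d"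
  shows "(i, j) \<in> {(a, b), (b, a)}"
proof -
  have eq: "hdist (xs ! i) (xs ! j) = d" using assms d_le_hdist by (simp add: le_antisym)
  then have "hdist (xs ! j) (xs ! i) = d" using hdist_commute[of "xs ! i" "xs ! j"] length_nth assms by simp
  then show ?thesis using eq assms pair_unique[of i j] pair_unique[of j i] by (cases "i < j") auto
qed

lemma d_le_m: "d \<le> m"
  using pair hdist_le_length[of "xs ! a" "xs ! b"] length_nth[of a] by simp

lemma blen_trans: "v \<le> u \<Longrightarrow> blen u \<le> B \<Longrightarrow> blen v \<le> B"
  using blen_mono le_trans by blast

lemma blen_d: "v \<le> d \<Longrightarrow> blen v \<le> B"
  using d_le_m blen_m by (meson blen_trans le_trans)

lemma blen_owner: "v \<le> n \<Longrightarrow> blen v \<le> B"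
  by (rule blen_trans[OF _ blen_n])

definition has_input :: "store \<Rightarrow> bool" where
  "has_input s \<longleftrightarrow> regs s 0 = n \<and> regs s 1 = m \<and> regs s 2 = d \<and>
     (\<forall>i<n. \<forall>k<m. arrs s 0 (i * m + k) = of_bool (xs ! i ! k))"

lemma has_input_set_reg [simp]: "2 < x \<Longrightarrow> has_input (set_reg x v s) \<longleftrightarrow> has_input s"
  and has_input_set_arr [simp]: "0 < A \<Longrightarrow> has_input (set_arr A i v s) \<longleftrightarrow> has_input s"
  by (auto simp: has_input_def)

lemma has_inputD:
  assumes "has_input s"
  shows "regs s 0 = n" "regs s (Suc 0) = m" "regs s 2 = d"
    "i < n \<Longrightarrow> k < m \<Longrightarrow> arrs s 0 (i * m + k) = of_bool (xs ! i ! k)"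
  using assms by (auto simp: has_input_def)

definition correct :: "store \<Rightarrow> bool" where
  "correct s \<longleftrightarrow> (regs s 7, regs s 8) \<in> {(a, b), (b, a)}"

lemma terminates_brute_force:
  assumes "has_input s"
  shows "terminates B brute_force s (n * (n * (4 * m + 18) + 10)) correct"
proof -
  have dist: "terminates B (For 5 1 (Assign 6 (Op Add (Reg 6) (Op Sub (Const 1)
               (Op Eq (Read 0 (Op Add (Op Mul (Reg 3) (Reg 1)) (Reg 5)))
                      (Read 0 (Op Add (Op Mul (Reg 4) (Reg 1)) (Reg 5)))))))) s (4 * m + 3)
      (\<lambda>s'. has_input s' \<and> regs s' 3 = i \<and> regs s' 4 = j \<and> regs s' 7 = regs s 7 \<and>
        regs s' 8 = regs s 8 \<and> regs s' 6 = hdist (xs ! i) (xs ! j))"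
    if "has_input s" "regs s 3 = i" "regs s 4 = j" "regs s 6 = 0" "i < n" "j < n" for s i j
  proof (rule terminates_For[where M = m and N = 1 and I = "\<lambda>k s'. has_input s' \<and> regs s' 3 = i \<and>
      regs s' 4 = j \<and> regs s' 7 = regs s 7 \<and> regs s' 8 = regs s 8 \<and>
      regs s' 6 = (\<Sum>l<k. of_bool (xs ! i ! l \<noteq> xs ! j ! l))"], goal_cases)
    case (5 k s')
    have "(\<Sum>l<k. of_bool (xs ! i ! l \<noteq> xs ! j ! l)) \<le> (\<Sum>l<k. 1 :: nat)" by (intro sum_mono) simp
    then have "Suc (\<Sum>l<k. of_bool (xs ! i ! l \<noteq> xs ! j ! l)) \<le> m" using 5 by simp
    then have "blen (Suc (\<Sum>l<k. of_bool (xs ! i ! l \<noteq> xs ! j ! l))) \<le> B"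
      using blen_m by (rule blen_trans)
    moreover from this have "blen (\<Sum>l<k. of_bool (xs ! i ! l \<noteq> xs ! j ! l)) \<le> B"
      by (rule blen_trans[rotated]) simp
    ultimately show ?case using 5 that
      by (intro terminates_Assign) (auto simp: has_inputD)
  next
    case (6 s')
    then show ?case using that by (simp add: hdist_sum length_nth)
  qed (use that blen_m in \<open>auto simp: has_inputD\<close>)
  have inner: "terminates B (Seq (Assign 6 (Const 0))
       (Seq (For 5 1 (Assign 6 (Op Add (Reg 6) (Op Sub (Const 1)
               (Op Eq (Read 0 (Op Add (Op Mul (Reg 3) (Reg 1)) (Reg 5)))
                      (Read 0 (Op Add (Op Mul (Reg 4) (Reg 1)) (Reg 5))))))))
         (If (Op Mul (Op Less (Reg 3) (Reg 4)) (Op Eq (Reg 6) (Reg 2)))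
           (Seq (Assign 7 (Reg 3)) (Assign 8 (Reg 4))) Skip))) s (4 * m + 12)
      (\<lambda>s'. has_input s' \<and> regs s' 3 = i \<and> regs s' 4 = j \<and>
        (if (i, j) = (a, b) then regs s' 7 = a \<and> regs s' 8 = b
         else regs s' 7 = regs s 7 \<and> regs s' 8 = regs s 8))"
    if "has_input s" "regs s 3 = i" "regs s 4 = j" "i < n" "j < n" for s i j
    apply (rule terminates_Seq[where ?N1.0 = 1 and ?N2.0 = "4 * m + 10"])
     apply (rule terminates_Assign)
       apply (use blen_d[of 0] in simp)
      apply (rule terminates_Seq[where ?N1.0 = "4 * m + 3" and ?N2.0 = 5])
       apply (rule terminates_mono[OF dist[of _ i j] order_refl])
             apply (use that in simp_all)
    apply (rule terminates_If[where ?N1.0 = 3])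
      apply (rule terminates_Seq[where ?N1.0 = 1 and ?N2.0 = 1])
       apply (rule terminates_Assign)
         apply (use that blen_owner[of i] in simp)
        apply (rule terminates_Assign)
          apply (use that blen_owner[of j] pair_unique[of i j] in \<open>simp_all add: has_inputD\<close>)
    apply (rule terminates_Skip)
     apply (use that pair_unique[of i j] pair in \<open>auto simp: has_inputD split: if_splits\<close>)
    done
  show ?thesis unfolding brute_force_def
  proof (rule terminates_For[where M = n and N = "n * (4 * m + 15) + 3" and
        I = "\<lambda>i s'. has_input s' \<and> (a < i \<longrightarrow> regs s' 7 = a \<and> regs s' 8 = b)"], goal_cases)
    case (5 i s')
    show ?case
    \<comment> \<open>The pairs are visited in lexicographic order. Only \<open>(a, b)\<close>
      passes the test, so its indices stay in registers 7 and 8 from then on.\<close>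
    proof (rule terminates_For[where M = n and N = "4 * m + 12" and
          I = "\<lambda>j s'. has_input s' \<and> regs s' 3 = i \<and>
            (a < i \<or> a = i \<and> b < j \<longrightarrow> regs s' 7 = a \<and> regs s' 8 = b)"], goal_cases)
      case (5 j s'')
      show ?case
        by (rule terminates_mono[OF inner[of s'' i j] order_refl])
          (use 5 \<open>i < n\<close> in \<open>auto simp: has_inputD less_Suc_eq split: if_splits\<close>)
    qed (use 5 blen_n pair in \<open>auto simp: has_inputD less_Suc_eq\<close>)
  next
    case (6 s')
    then show ?case using pair by (auto simp: correct_def)
  qed (use assms blen_n pair in \<open>auto simp: has_inputD algebra_simps\<close>)
qed

end


section \<open>Programs enumerating balls and searching for collisions\<close>

definition extend_round :: com where
  "extend_round =
     Seq (Assign 11 (Read 0 (Op Add (Op Mul (Read 2 (Reg 4)) (Reg 1)) (Reg 3))))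
     (Seq (If (Op Less (Read 3 (Reg 4)) (Reg 9))
         (Seq (Write 1 (Reg 6) (Op Add (Op Mul (Const 2) (Read 1 (Reg 4))) (Op Sub (Const 1) (Reg 11))))
         (Seq (Write 2 (Reg 6) (Read 2 (Reg 4)))
         (Seq (Write 3 (Reg 6) (Op Add (Read 3 (Reg 4)) (Const 1)))
           (Assign 6 (Op Add (Reg 6) (Const 1))))))
         Skip)
       (Write 1 (Reg 4) (Op Add (Op Mul (Const 2) (Read 1 (Reg 4))) (Reg 11))))"

definition fill_table :: com where
  "fill_table = If (Op Less (Reg 10) (Read 3 (Reg 3))) Skip
     (Write 4 (Read 1 (Reg 3)) (Op Add (Read 2 (Reg 3)) (Const 1)))"

definition search_table :: com where
  "search_table = Seq (Assign 11 (Read 4 (Read 1 (Reg 3))))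
     (If (Op Mul (Reg 11) (Op Sub (Const 1) (Op Eq (Reg 11) (Op Add (Read 2 (Reg 3)) (Const 1)))))
       (Seq (Assign 7 (Read 2 (Reg 3))) (Assign 8 (Op Sub (Reg 11) (Const 1)))) Skip)"

text \<open>
  Entry \<open>u\<close> of the growing list is spread over the arrays 1 to 3: the code of a word \<open>v\<close>, the
  index \<open>i\<close> of an input vector, and the distance of \<open>v\<close> to the prefix of that vector of the same
  length. One round appends one more coordinate to all words. In the end the list holds the words
  within distance \<open>\<lceil>d/2\<rceil>\<close> of each vector, and array 4 maps the words within distance \<open>\<lfloor>d/2\<rfloor>\<close> of
  vector \<open>i\<close> to \<open>i + 1\<close>.
\<close>

definition enumerate_balls :: com where
  "enumerate_balls =
     Seq (Assign 10 (Op Quo (Reg 2) (Const 2)))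
     (Seq (Assign 9 (Op Sub (Reg 2) (Reg 10)))
     (Seq (For 3 0 (Write 2 (Reg 3) (Reg 3)))
     (Seq (Assign 6 (Reg 0))
     (Seq (For 3 1 (Seq (Assign 5 (Reg 6)) (For 4 5 extend_round)))
     (Seq (For 3 6 fill_table)
       (For 3 6 search_table))))))"

text \<open>The binary value with the most significant bit first, so that appending a coordinate is
  a doubling. It serves as the address of the word in array 4.\<close>

definition code :: "bool list \<Rightarrow> nat" where
  "code v = foldl (\<lambda>z c. 2 * z + of_bool c) 0 v"

lemma code_simps [simp]: "code [] = 0" "code (v @ [c]) = 2 * code v + of_bool c"
  by (simp_all add: code_def)

lemma code_less: "code v < 2 ^ length v"
  by (induction v rule: rev_induct) auto

lemma code_inject: "length u = length v \<Longrightarrow> code u = code v \<Longrightarrow> u = v"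
proof (induction u arbitrary: v rule: rev_induct)
  case Nil
  then show ?case by simp
next
  case (snoc c u)
  obtain v' c' where v: "v = v' @ [c']" using snoc.prems(1) by (cases v rule: rev_cases) auto
  have eq: "2 * code u + of_bool c = 2 * code v' + of_bool c'" using snoc.prems(2) v by simp
  then have "c = c'" by (auto simp: of_bool_def split: if_splits) presburger+
  then show ?case using snoc eq v by simp
qed

section \<open>Balls around prefixes as sets of list entries\<close>

definition entry :: "store \<Rightarrow> nat \<Rightarrow> nat \<times> nat \<times> nat" where
  "entry s u = (arrs s 1 u, arrs s 2 u, arrs s 3 u)"

abbreviation weight :: "nat \<times> nat \<times> nat \<Rightarrow> nat" where
  "weight p \<equiv> snd (snd p)"

lemma entry_set_reg [simp]: "entry (set_reg x v s) = entry s"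
  by (rule ext) (simp add: entry_def)

text \<open>\<open>L\<close> caps the length of the list. \<open>list_bound\<close> has Chernoff's
  form: \<open>l\<close> entries of weight at least \<open>y ^ e\<close> each, within a total of
  \<open>n * (1 + y) ^ m\<close>.\<close>

locale ball_enumeration = closest_pair_instance +
  fixes e f :: nat and L :: nat and y :: real
  assumes f_def: "f = d div 2" and e_def: "e = d - d div 2"
    and y_pos: "0 < y" and y_le: "y \<le> 1"
    and list_bound: "\<And>l. real l * y ^ e \<le> real n * (1 + y) ^ m \<Longrightarrow> l \<le> L"
    and blen_L: "blen L \<le> B" and blen_words: "blen (2 ^ m) \<le> B"
begin

definition balls :: "nat \<Rightarrow> (nat \<times> nat \<times> nat) set" where
  "balls k = {(code v, i, hdist v (take k (xs ! i))) | v i.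
     i < n \<and> length v = k \<and> hdist v (take k (xs ! i)) \<le> e}"

definition keep :: "nat \<Rightarrow> nat \<times> nat \<times> nat \<Rightarrow> nat \<times> nat \<times> nat" where
  "keep k = (\<lambda>(z, i, w). (2 * z + of_bool (xs ! i ! k), i, w))"

definition flip :: "nat \<Rightarrow> nat \<times> nat \<times> nat \<Rightarrow> nat \<times> nat \<times> nat" where
  "flip k = (\<lambda>(z, i, w). (2 * z + of_bool (\<not> xs ! i ! k), i, w + 1))"

lemma weight_keep [simp]: "weight (keep k p) = weight p"
  and weight_flip [simp]: "weight (flip k p) = Suc (weight p)"
  by (auto simp: keep_def flip_def split: prod.splits)

lemma ballsD: "(z, i, w) \<in> balls k \<Longrightarrow> i < n \<and> z < 2 ^ k \<and> w \<le> e"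
  using code_less by (auto simp: balls_def)

lemma weight_balls: "p \<in> balls k \<Longrightarrow> weight p \<le> e"
  using ballsD by (cases p) auto

lemma balls_0: "balls 0 = (\<lambda>i. (0, i, 0)) ` {..<n}"
  by (auto simp: balls_def hdist_def)

text \<open>Appending a coordinate never decreases the distance to a prefix, so every word within
  radius \<open>e\<close> extends one that was within \<open>e\<close> before. Copying the bit of
  the vector preserves the distance, the opposite bit adds 1.\<close>

lemma balls_Suc:
  assumes "k < m"
  shows "balls (Suc k) = keep k ` balls k \<union> flip k ` {p \<in> balls k. weight p < e}"
proof (intro equalityI subsetI)
  fix p assume "p \<in> balls (Suc k)"
  then obtain v i where p: "p = (code v, i, hdist v (take (Suc k) (xs ! i)))" "i < n"
    "length v = Suc k" "hdist v (take (Suc k) (xs ! i)) \<le> e"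
    by (auto simp: balls_def)
  obtain v' c where v: "v = v' @ [c]" using p(3) by (cases v rule: rev_cases) auto
  let ?q = "(code v', i, hdist v' (take k (xs ! i)))"
  have h: "hdist v (take (Suc k) (xs ! i)) = hdist v' (take k (xs ! i)) + of_bool (c \<noteq> xs ! i ! k)"
    using hdist_snoc[of v' k "xs ! i" c] p v assms length_nth by simp
  have q: "?q \<in> balls k" using p v h by (auto simp: balls_def)
  show "p \<in> keep k ` balls k \<union> flip k ` {p \<in> balls k. weight p < e}"
  proof (cases "c = xs ! i ! k")
    case True
    then have "p = keep k ?q" using p v h by (simp add: keep_def)
    then show ?thesis using q by blast
  next
    case False
    then have "p = flip k ?q" "weight ?q < e" using p v h by (auto simp: flip_def)
    then show ?thesis using q by blast
  qed
next
  fix p assume "p \<in> keep k ` balls k \<union> flip k ` {p \<in> balls k. weight p < e}"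
  then consider q where "q \<in> balls k" "p = keep k q" | q where "q \<in> balls k" "weight q < e" "p = flip k q"
    by blast
  then show "p \<in> balls (Suc k)"
  proof cases
    case 1
    then obtain v i where q: "q = (code v, i, hdist v (take k (xs ! i)))" "i < n"
      "length v = k" "hdist v (take k (xs ! i)) \<le> e" by (auto simp: balls_def)
    then show ?thesis using 1 hdist_snoc[of v k "xs ! i" "xs ! i ! k"] assms length_nth
      by (auto simp: balls_def keep_def intro!: exI[of _ "v @ [xs ! i ! k]"])
  next
    case 2
    then obtain v i where q: "q = (code v, i, hdist v (take k (xs ! i)))" "i < n"
      "length v = k" "hdist v (take k (xs ! i)) \<le> e" by (auto simp: balls_def)
    then show ?thesis using 2 hdist_snoc[of v k "xs ! i" "\<not> xs ! i ! k"] assms length_nth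
      by (auto simp: balls_def flip_def intro!: exI[of _ "v @ [\<not> xs ! i ! k]"])
  qed
qed

text \<open>The weights \<open>w\<close> are not tied to a store, so that the bound also applies to
  a list whose next entry has not yet been written.\<close>

lemma list_length_le:
  assumes "\<And>u. u < l \<Longrightarrow> w u \<le> e" "(\<Sum>u<l. y ^ w u) \<le> real n * (1 + y) ^ k" "k \<le> m"
  shows "l \<le> L"
proof (rule list_bound)
  have "real l * y ^ e = (\<Sum>u<l. y ^ e)" by simp
  also have "\<dots> \<le> (\<Sum>u<l. y ^ w u)"
    using assms(1) y_pos y_le by (intro sum_mono power_decreasing) auto
  also note assms(2)
  also have "real n * (1 + y) ^ k \<le> real n * (1 + y) ^ m"
    using y_pos assms(3) by (intro mult_left_mono power_increasing) auto
  finally show "real l * y ^ e \<le> real n * (1 + y) ^ m" .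
qed

text \<open>Equal codes mean equal words, so the triangle inequality through the common word gives
  distance at most \<open>e + f = d\<close>.\<close>

lemma collision_correct:
  assumes "(z, i, w) \<in> balls m" "(z, j, w') \<in> balls m" "w' \<le> f" "i \<noteq> j"
  shows "(i, j) \<in> {(a, b), (b, a)}"
proof -
  obtain v where v: "z = code v" "length v = m" "w = hdist v (xs ! i)" "i < n" "w \<le> e"
    using assms(1) length_nth by (auto simp: balls_def)
  obtain v' where v': "z = code v'" "length v' = m" "w' = hdist v' (xs ! j)" "j < n"
    using assms(2) length_nth by (auto simp: balls_def)
  have "v' = v" using code_inject v v' by metis
  have "hdist (xs ! i) (xs ! j) \<le> hdist (xs ! i) v + hdist v (xs ! j)"
    using v v' length_nth by (intro hdist_triangle) auto
  also have "\<dots> \<le> e + f"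
    using v v' \<open>v' = v\<close> assms(3) length_nth hdist_commute[of "xs ! i" v] by simp
  also have "\<dots> = d" by (simp add: e_def f_def)
  finally show ?thesis using close_pair v v' assms(4) by simp
qed

text \<open>This common word ensures that the search meets a collision: vector \<open>a\<close> can
  enter it into the table, and \<open>b\<close> lists it too.\<close>

lemma midpoint_entries:
  obtains z where "(z, a, f) \<in> balls m" "(z, b, e) \<in> balls m"
proof -
  have ab: "a < n" "b < n" using pair by auto
  obtain v where v: "length v = m" "hdist v (xs ! a) = f" "hdist v (xs ! b) = e"
    using hdist_midpoint[of "xs ! a" m "xs ! b" f] length_nth ab pair(3)
    by (auto simp: f_def e_def)
  have "f \<le> e" by (simp add: e_def f_def)
  then show ?thesis
    using that[of "code v"] v ab length_nth by (auto simp: balls_def intro!: exI[of _ v])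
qed

section \<open>One round of the enumeration and the growth of the list\<close>

lemma terminates_extend_round:
  assumes s: "has_input s" "regs s 3 = k" "regs s 4 = t" "regs s 9 = e" "t < regs s 6"
    and len: "weight (entry s t) < e \<Longrightarrow> regs s 6 < L"
    and p: "entry s t \<in> balls k" "k < m"
  shows "terminates B extend_round s 12 (\<lambda>s'. has_input s' \<and>
      (\<forall>x. x \<notin> {6, 11} \<longrightarrow> regs s' x = regs s x) \<and> arrs s' 4 = arrs s 4 \<and>
      (if weight (entry s t) < e
       then regs s' 6 = Suc (regs s 6) \<and>
         entry s' = (entry s)(regs s 6 := flip k (entry s t), t := keep k (entry s t))
       else regs s' 6 = regs s 6 \<and> entry s' = (entry s)(t := keep k (entry s t))))"
proof -
  \<comment> \<open>Register 3 is the coordinate, 4 the current entry, 6 the length of the list, 9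
    the radius \<open>e\<close>, and 11 receives the bit of the vector.\<close>
  obtain z i w where E: "entry s t = (z, i, w)" by (cases "entry s t")
  then have A: "arrs s (Suc 0) t = z" "arrs s 2 t = i" "arrs s 3 t = w" by (auto simp: entry_def)
  have bnd: "i < n" "z < 2 ^ k" "w \<le> e" using ballsD[of z i w k] p E by auto
  have "(2::nat) ^ Suc k \<le> 2 ^ m" using p(2) by (intro power_increasing) auto
  then have z: "blen (2 * z + c) \<le> B" if "c \<le> 1" for c
    using bnd(2) that by (intro blen_trans[OF _ blen_words]) simp
  have b: "blen (of_bool c) \<le> B" for c
    using two_le_n by (intro blen_owner) simp
  have w: "blen (Suc w) \<le> B" if "w < e" using that by (intro blen_d) (simp add: e_def)
  \<comment> \<open>Here \<open>len\<close> enters: the incremented length must still fit into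
    \<open>B\<close> bits.\<close>
  have l: "blen (Suc (regs s 6)) \<le> B" if "w < e"
    using that len E by (intro blen_trans[OF _ blen_L]) simp
  have bit: "arrs s 0 (i * m + k) = of_bool (xs ! i ! k)"
    using has_inputD(4)[OF s(1) bnd(1) p(2)] .
  note z0 = z[of 0, simplified] and z1 = z[of 1, simplified]
  \<comment> \<open>The flipped copy is appended before entry \<open>t\<close> is overwritten, as
    both new codes are computed from the old one.\<close>
  show ?thesis
    unfolding extend_round_def
    apply (rule terminates_Seq[where ?N1.0 = 1 and ?N2.0 = 10])
     apply (rule terminates_Assign)
       apply (use s A b bit in \<open>simp add: has_inputD(2)[OF s(1)]\<close>)
      apply (rule terminates_Seq[where ?N1.0 = 8 and ?N2.0 = 1])
       apply (rule terminates_If[where ?N1.0 = 7])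
         apply (rule terminates_Seq[where ?N1.0 = 1 and ?N2.0 = 5])
          apply (rule terminates_Write)
            apply (use s A z0 z1 bit in \<open>simp add: has_inputD(2)[OF s(1)]\<close>)
           apply (rule terminates_Seq[where ?N1.0 = 1 and ?N2.0 = 3])
            apply (rule terminates_Write)
              apply (use s A bnd blen_owner[of i] in simp)
             apply (rule terminates_Seq[where ?N1.0 = 1 and ?N2.0 = 1])
              apply (rule terminates_Write)
                apply (use s A w in simp)
               apply (rule terminates_Assign)
                 apply (use s A l in simp)
                apply (rule terminates_Write)
                  apply (use s A z0 z1 bit in \<open>simp add: has_inputD(2)[OF s(1)]\<close>)
                 apply (use s A E bit in \<open>force simp: entry_def fun_eq_iff keep_def flip_def has_inputD(2)[OF s(1)]\<close>)
                apply simp_all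
    apply (rule terminates_Skip)
     apply (rule terminates_Write)
       apply (use s A z0 z1 bit in \<open>simp add: has_inputD(2)[OF s(1)]\<close>)
      apply (use s A E bit in \<open>force simp: entry_def fun_eq_iff keep_def flip_def has_inputD(2)[OF s(1)]\<close>)
     apply simp_all
    done
qed

text \<open>
  The list length is bounded through the potential \<open>\<Sum>u. y ^ weight (entry s u)\<close>: it grows by a
  factor of at most \<open>1 + y\<close> in each round, and each entry contributes at least \<open>y ^ e\<close>.
\<close>

definition round_inv :: "nat \<Rightarrow> store \<Rightarrow> bool" where
  "round_inv k s \<longleftrightarrow> has_input s \<and> regs s 9 = e \<and> regs s 10 = f \<and> (\<forall>z. arrs s 4 z = 0) \<and>
     entry s ` {..<regs s 6} = balls k \<and>
     (\<Sum>u<regs s 6. y ^ weight (entry s u)) \<le> real n * (1 + y) ^ k"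

lemma round_inv_length: "round_inv k s \<Longrightarrow> k \<le> m \<Longrightarrow> regs s 6 \<le> L"
proof (rule list_length_le[where w = "\<lambda>u. weight (entry s u)"])
  show "weight (entry s u) \<le> e" if "round_inv k s" "u < regs s 6" for u
    using that by (intro weight_balls[of _ k]) (auto simp: round_inv_def)
qed (auto simp: round_inv_def)

text \<open>The state within a round that began in \<open>s\<close>, after \<open>t\<close> entries:
  those below \<open>t\<close> are rewritten in place, those from \<open>t\<close> up to the old
  length are untouched, and flipped copies follow. An extended entry adds \<open>y\<close> times its
  weight to the potential.\<close>

definition extend_inv :: "nat \<Rightarrow> store \<Rightarrow> nat \<Rightarrow> store \<Rightarrow> bool" where
  "extend_inv k s t s' \<longleftrightarrow> has_input s' \<and> regs s' 3 = k \<and> regs s' 9 = e \<and> regs s' 10 = f \<and>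
     (\<forall>z. arrs s' 4 z = 0) \<and> regs s 6 \<le> regs s' 6 \<and>
     (\<forall>u. t \<le> u \<and> u < regs s 6 \<longrightarrow> entry s' u = entry s u) \<and>
     entry s' ` ({..<t} \<union> {regs s 6..<regs s' 6}) =
       keep k ` entry s ` {..<t} \<union> flip k ` {p \<in> entry s ` {..<t}. weight p < e} \<and>
     (\<Sum>u<regs s' 6. y ^ weight (entry s' u)) \<le>
       (\<Sum>u<regs s 6. y ^ weight (entry s u)) + y * (\<Sum>u<t. y ^ weight (entry s u))"

lemma extend_inv_weight:
  assumes "round_inv k s" "extend_inv k s t s'" "t \<le> regs s 6" "u < regs s' 6"
  shows "weight (entry s' u) \<le> e"
proof (cases "t \<le> u \<and> u < regs s 6")
  case True
  then have "entry s' u \<in> balls k" using assms(1,2) by (auto simp: extend_inv_def round_inv_def)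
  then show ?thesis by (rule weight_balls)
next
  case False
  then have "u \<in> {..<t} \<union> {regs s 6..<regs s' 6}" using assms(4) by auto
  then have "entry s' u \<in> keep k ` entry s ` {..<t} \<union> flip k ` {p \<in> entry s ` {..<t}. weight p < e}"
    using assms(2) unfolding extend_inv_def by blast
  moreover have "entry s ` {..<t} \<subseteq> balls k" using assms(1,3) by (auto simp: round_inv_def)
  ultimately show ?thesis using weight_balls by fastforce
qed

text \<open>Processing all old entries multiplies the potential by at most \<open>1 + y\<close>. As
  the terms are nonnegative, the same bound holds in the middle of a round.\<close>

lemma extend_inv_sum:
  assumes "round_inv k s" "t \<le> regs s 6"
  shows "(\<Sum>u<regs s 6. y ^ weight (entry s u)) + y * (\<Sum>u<t. y ^ weight (entry s u))
    \<le> real n * (1 + y) ^ Suc k"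
proof -
  let ?S = "\<Sum>u<regs s 6. y ^ weight (entry s u)"
  have "(\<Sum>u<t. y ^ weight (entry s u)) \<le> ?S"
    using assms(2) y_pos by (intro sum_mono2) auto
  then have "?S + y * (\<Sum>u<t. y ^ weight (entry s u)) \<le> ?S + y * ?S"
    using y_pos by simp
  also have "\<dots> = (1 + y) * ?S" by (simp add: algebra_simps)
  also have "\<dots> \<le> (1 + y) * (real n * (1 + y) ^ k)"
    using assms(1) y_pos by (intro mult_left_mono) (auto simp: round_inv_def)
  finally show ?thesis by (simp add: algebra_simps)
qed

text \<open>An appended copy raises the potential by \<open>y * y ^ weight (entry s t)\<close>.
  Without a copy it is unchanged and the slack is nonnegative.\<close>

lemma extend_inv_step:
  assumes r: "round_inv k s" and i: "extend_inv k s t s'" and t: "t < regs s 6"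
    and in': "has_input s''" and regs: "\<forall>x. x \<notin> {6, 11} \<longrightarrow> regs s'' x = regs s' x"
    and table: "arrs s'' 4 = arrs s' 4"
    and upd: "if weight (entry s' t) < e
       then regs s'' 6 = Suc (regs s' 6) \<and>
         entry s'' = (entry s')(regs s' 6 := flip k (entry s' t), t := keep k (entry s' t))
       else regs s'' 6 = regs s' 6 \<and> entry s'' = (entry s')(t := keep k (entry s' t))"
  shows "extend_inv k s (Suc t) s''"
proof -
  let ?l = "regs s 6" and ?l' = "regs s' 6" and ?E = "entry s" and ?E' = "entry s'"
  have old: "?E' t = ?E t" and le: "?l \<le> ?l'" using i t by (auto simp: extend_inv_def)
  have img: "?E' ` ({..<t} \<union> {?l..<?l'}) =
      keep k ` ?E ` {..<t} \<union> flip k ` {p \<in> ?E ` {..<t}. weight p < e}"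
    using i by (simp add: extend_inv_def)
  have sum: "(\<Sum>u<?l'. y ^ weight (?E' u)) \<le>
      (\<Sum>u<?l. y ^ weight (?E u)) + y * (\<Sum>u<t. y ^ weight (?E u))"
    using i by (simp add: extend_inv_def)
  have rest: "entry s'' u = ?E u" if "Suc t \<le> u" "u < ?l" for u
    using that upd i le by (auto simp: extend_inv_def split: if_splits)
  have cong: "entry s'' ` ({..<t} \<union> {?l..<?l'}) = ?E' ` ({..<t} \<union> {?l..<?l'})"
    using upd t le by (intro image_cong) (auto split: if_splits)
  have "entry s'' ` ({..<Suc t} \<union> {?l..<regs s'' 6}) =
      keep k ` ?E ` {..<Suc t} \<union> flip k ` {p \<in> ?E ` {..<Suc t}. weight p < e}"
  proof (cases "weight (?E t) < e")
    case True
    then have "{..<Suc t} \<union> {?l..<regs s'' 6} = insert t (insert ?l' ({..<t} \<union> {?l..<?l'}))"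
      using upd le old by auto
    moreover have "entry s'' t = keep k (?E t)" "entry s'' ?l' = flip k (?E t)"
      using upd le t True old by auto
    ultimately have "entry s'' ` ({..<Suc t} \<union> {?l..<regs s'' 6}) =
        insert (keep k (?E t)) (insert (flip k (?E t)) (?E' ` ({..<t} \<union> {?l..<?l'})))"
      by (simp only: image_insert cong)
    moreover have "{p \<in> ?E ` {..<Suc t}. weight p < e} = insert (?E t) {p \<in> ?E ` {..<t}. weight p < e}"
      using True by (auto simp: less_Suc_eq)
    moreover have "?E ` {..<Suc t} = insert (?E t) (?E ` {..<t})"
      by (simp add: lessThan_Suc)
    ultimately show ?thesis unfolding img by auto
  next
    case False
    then have "{..<Suc t} \<union> {?l..<regs s'' 6} = insert t ({..<t} \<union> {?l..<?l'})"
      using upd le old by auto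
    moreover have "entry s'' t = keep k (?E t)" using upd False old by auto
    ultimately have "entry s'' ` ({..<Suc t} \<union> {?l..<regs s'' 6}) =
        insert (keep k (?E t)) (?E' ` ({..<t} \<union> {?l..<?l'}))"
      by (simp only: image_insert cong)
    moreover have "{p \<in> ?E ` {..<Suc t}. weight p < e} = {p \<in> ?E ` {..<t}. weight p < e}"
      using False by (auto simp: less_Suc_eq)
    moreover have "?E ` {..<Suc t} = insert (?E t) (?E ` {..<t})"
      by (simp add: lessThan_Suc)
    ultimately show ?thesis unfolding img by auto
  qed
  moreover have "(\<Sum>u<regs s'' 6. y ^ weight (entry s'' u)) \<le>
      (\<Sum>u<?l. y ^ weight (?E u)) + y * (\<Sum>u<Suc t. y ^ weight (?E u))"
  proof (cases "weight (?E t) < e")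
    case True
    then have "(\<Sum>u<regs s'' 6. y ^ weight (entry s'' u)) =
        (\<Sum>u<?l'. y ^ weight (entry s'' u)) + y * y ^ weight (?E t)"
      using upd old t le by simp
    also have "(\<Sum>u<?l'. y ^ weight (entry s'' u)) = (\<Sum>u<?l'. y ^ weight (?E' u))"
      using True upd old by (intro sum.cong) auto
    finally show ?thesis using sum by (simp add: algebra_simps)
  next
    case False
    then have "(\<Sum>u<regs s'' 6. y ^ weight (entry s'' u)) = (\<Sum>u<?l'. y ^ weight (?E' u))"
      using upd old by (intro sum.cong) auto
    moreover have "0 \<le> y * y ^ weight (?E t)" using y_pos by simp
    ultimately show ?thesis using sum by (simp add: algebra_simps)
  qed
  moreover have "regs s 6 \<le> regs s'' 6" using upd le by (simp split: if_splits)
  ultimately show ?thesis using in' regs table rest i by (simp add: extend_inv_def)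
qed

text \<open>Register 5 freezes the old length, so that copies appended in this round are not
  extended again.\<close>

lemma terminates_round:
  assumes r: "round_inv k s" and k: "k < m" "regs s 3 = k"
  shows "terminates B (Seq (Assign 5 (Reg 6)) (For 4 5 extend_round)) s (15 * L + 5)
    (\<lambda>s'. regs s' 3 = k \<and> round_inv (Suc k) s')"
proof -
  have len: "regs s 6 \<le> L" using round_inv_length r k by simp
  have blen_len: "blen (regs s 6) \<le> B" using len blen_L by (rule blen_trans)
  have for_loop: "terminates B (For 4 5 extend_round) (set_reg 5 (regs s 6) s) (15 * L + 3)
    (\<lambda>s'. regs s' 3 = k \<and> round_inv (Suc k) s')"
  proof (rule terminates_For[where M = "regs s 6" and N = 12 and I = "extend_inv k s"], goal_cases)
    case 1
    then show ?case using r k by (simp add: extend_inv_def round_inv_def)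
  next
    case (5 t s')
    have old: "entry s' t = entry s t" and le: "regs s 6 \<le> regs s' 6"
      and s': "has_input s'" "regs s' 3 = k" "regs s' 9 = e"
      using 5 by (auto simp: extend_inv_def)
    have ball: "entry s t \<in> balls k" using r 5(1) by (auto simp: round_inv_def)
    have "regs s' 6 < L" if w: "weight (entry s t) < e"
    proof -
      \<comment> \<open>The weights of the list as it will be after the coming append. Bounding that
        longer list gives the strict inequality.\<close>
      let ?W = "\<lambda>u. if u = regs s' 6 then Suc (weight (entry s t)) else weight (entry s' u)"
      have "(\<Sum>u<Suc (regs s' 6). y ^ ?W u) =
          (\<Sum>u<regs s' 6. y ^ weight (entry s' u)) + y * y ^ weight (entry s t)" by simp
      also have "\<dots> \<le> (\<Sum>u<regs s 6. y ^ weight (entry s u)) +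
          y * (\<Sum>u<Suc t. y ^ weight (entry s u))"
        using 5(2) by (simp add: extend_inv_def algebra_simps)
      also have "\<dots> \<le> real n * (1 + y) ^ Suc k"
        using extend_inv_sum[OF r, of "Suc t"] 5(1) by simp
      finally have "Suc (regs s' 6) \<le> L"
        using extend_inv_weight[OF r 5(2)] 5(1) w k
        by (intro list_length_le[where w = ?W and k = "Suc k"]) (auto simp: less_Suc_eq)
      then show ?thesis by simp
    qed
    then have "terminates B extend_round s' 12 (\<lambda>s''. has_input s'' \<and>
      (\<forall>x. x \<notin> {6, 11} \<longrightarrow> regs s'' x = regs s' x) \<and> arrs s'' 4 = arrs s' 4 \<and>
      (if weight (entry s' t) < e
       then regs s'' 6 = Suc (regs s' 6) \<and>
         entry s'' = (entry s')(regs s' 6 := flip k (entry s' t), t := keep k (entry s' t))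
       else regs s'' 6 = regs s' 6 \<and> entry s'' = (entry s')(t := keep k (entry s' t))))"
      using 5 s' old le ball k by (intro terminates_extend_round) auto
    then show ?case
    proof (rule terminates_mono[OF _ order_refl], goal_cases)
      case (1 s'')
      then have "extend_inv k s (Suc t) s''"
        by (intro extend_inv_step[OF r 5(2,1)]) blast+
      then have "extend_inv k s (Suc t) (set_reg 4 (Suc t) s'')"
        by (simp add: extend_inv_def)
      then show ?case using 1 5 by simp
    qed
  next
    case (6 s')
    let ?l = "regs s 6" and ?l' = "regs s' 6"
    have le: "?l \<le> ?l'" using 6(1) by (simp add: extend_inv_def)
    have "{..<?l'} = {..<?l} \<union> {?l..<?l'}" using le by auto
    then have "entry s' ` {..<?l'} = keep k ` entry s ` {..<?l} \<union>
        flip k ` {p \<in> entry s ` {..<?l}. weight p < e}"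
      using 6(1) by (simp add: extend_inv_def)
    then have "entry s' ` {..<?l'} = balls (Suc k)"
      using r balls_Suc[OF k(1)] by (simp add: round_inv_def)
    moreover have "(\<Sum>u<?l'. y ^ weight (entry s' u)) \<le> real n * (1 + y) ^ Suc k"
      using 6(1) extend_inv_sum[OF r order_refl] by (auto simp: extend_inv_def)
    ultimately show ?case using 6(1) by (simp add: extend_inv_def round_inv_def)
  qed (use len blen_len in simp_all)
  show ?thesis
    by (rule terminates_Seq[where ?N1.0 = 1 and ?N2.0 = "15 * L + 3"], rule terminates_Assign)
      (use blen_len for_loop in simp_all)
qed

section \<open>The table of words and the search for a collision\<close>

lemma terminates_fill_table:
  assumes s: "has_input s" "regs s 10 = f" "regs s 6 = l" "entry s ` {..<l} = balls m"
    "\<forall>z. arrs s 4 z = 0" and l: "l \<le> L"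
  shows "terminates B (For 3 6 fill_table) s (5 * L + 3) (\<lambda>s'. has_input s' \<and> regs s' 6 = l \<and>
    entry s' ` {..<l} = balls m \<and>
    (\<forall>z. arrs s' 4 z \<noteq> 0 \<longrightarrow> (\<exists>j w. (z, j, w) \<in> balls m \<and> w \<le> f \<and> arrs s' 4 z = Suc j)) \<and>
    (\<forall>p\<in>balls m. weight p \<le> f \<longrightarrow> arrs s' 4 (fst p) \<noteq> 0))"
proof (rule terminates_For[where M = l and N = 2 and I = "\<lambda>t s'. has_input s' \<and> regs s' 10 = f \<and>
    regs s' 6 = l \<and> entry s' = entry s \<and>
    (\<forall>z. arrs s' 4 z \<noteq> 0 \<longrightarrow> (\<exists>j w. (z, j, w) \<in> balls m \<and> w \<le> f \<and> arrs s' 4 z = Suc j)) \<and>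
    (\<forall>u<t. weight (entry s u) \<le> f \<longrightarrow> arrs s' 4 (fst (entry s u)) \<noteq> 0)"], goal_cases)
  case (5 t s')
  obtain z i w where E: "entry s t = (z, i, w)" by (cases "entry s t")
  then have A: "arrs s' (Suc 0) t = z" "arrs s' 2 t = i" "arrs s' 3 t = w"
    using 5 by (auto simp: entry_def fun_eq_iff)
  have ball: "(z, i, w) \<in> balls m" using E s(4) 5(1) by (metis imageI lessThan_iff)
  then have i: "blen (Suc i) \<le> B" using ballsD[of z i w m] by (intro blen_owner) simp
  have ent: "entry (set_arr 4 z (Suc i) s') = entry s" using 5 by (simp add: entry_def fun_eq_iff)
  show ?case unfolding fill_table_def
  proof (rule terminates_If[where ?N1.0 = 1], goal_cases)
    case 1
    then show ?case using 5 E A by (intro terminates_Skip) (auto simp: less_Suc_eq split: if_splits)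
  next
    \<comment> \<open>An earlier owner of the same word may be overwritten. Both parts of the
      invariant only ask for some owner within distance \<open>f\<close>.\<close>
    case 2
    then have "w \<le> f" using 5 A by (simp split: if_splits)
    then show ?case using 5 E A i ball ent
      by (intro terminates_Write) (auto simp: less_Suc_eq)
  qed simp
next
  case (6 s')
  have "arrs s' 4 (fst p) \<noteq> 0" if "p \<in> balls m" "weight p \<le> f" for p
    using that 6 unfolding s(4)[symmetric] by auto
  then show ?case using 6 s(4) by auto
qed (use s l blen_trans[OF l blen_L] in auto)

text \<open>Every hit names the closest pair, so later hits overwrite the answer harmlessly; the
  midpoint guarantees at least one hit.\<close>

lemma terminates_search_table:
  assumes s: "has_input s" "regs s 6 = l" "entry s ` {..<l} = balls m"
    and sound: "\<forall>z. arrs s 4 z \<noteq> 0 \<longrightarrow> (\<exists>j w. (z, j, w) \<in> balls m \<and> w \<le> f \<and> arrs s 4 z = Suc j)"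
    and filled: "\<forall>p\<in>balls m. weight p \<le> f \<longrightarrow> arrs s 4 (fst p) \<noteq> 0"
    and l: "l \<le> L"
  shows "terminates B (For 3 6 search_table) s (9 * L + 3) correct"
proof -
  define hit where "hit u \<longleftrightarrow> arrs s 4 (fst (entry s u)) \<noteq> 0 \<and>
    arrs s 4 (fst (entry s u)) \<noteq> Suc (fst (snd (entry s u)))" for u
  show ?thesis
  proof (rule terminates_For[where M = l and N = 6 and I = "\<lambda>t s'. has_input s' \<and> regs s' 6 = l \<and>
      entry s' = entry s \<and> arrs s' 4 = arrs s 4 \<and> ((\<exists>u<t. hit u) \<longrightarrow> correct s')"], goal_cases)
    case 1
    show ?case using s by simp
  next
    case (5 t s')
    obtain z i w where E: "entry s t = (z, i, w)" by (cases "entry s t")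
    then have A: "arrs s' (Suc 0) t = z" "arrs s' 2 t = i" "arrs s' 3 t = w"
      using 5 by (auto simp: entry_def fun_eq_iff)
    have ball: "(z, i, w) \<in> balls m" using E s(3) 5(1) by (metis imageI lessThan_iff)
    then have i: "blen i \<le> B" using ballsD[of z i w m] by (intro blen_owner) simp
    have T: "blen (arrs s 4 z) \<le> B"
    proof (cases "arrs s 4 z = 0")
      case False
      then obtain j w' where "(z, j, w') \<in> balls m" "arrs s 4 z = Suc j" using sound by blast
      then show ?thesis using ballsD[of z j w' m] by (intro blen_owner) simp
    qed (simp add: blen_owner)
    have T': "blen (arrs s 4 z - Suc 0) \<le> B" using T by (rule blen_trans[rotated]) simp
    have hit: "(i, arrs s 4 z - 1) \<in> {(a, b), (b, a)}" if "hit t"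
    proof -
      have "arrs s 4 z \<noteq> 0" using that E by (simp add: hit_def)
      then obtain j w' where "(z, j, w') \<in> balls m" "w' \<le> f" "arrs s 4 z = Suc j"
        using sound by blast
      then show ?thesis using collision_correct[OF ball, of j w'] that E by (auto simp: hit_def)
    qed
    have correct_reg: "correct (set_reg x v r) \<longleftrightarrow> correct r" if "x \<noteq> 7" "x \<noteq> 8" for x v r
      using that by (simp add: correct_def)
    show ?case unfolding search_table_def
    proof (rule terminates_Seq[where ?N1.0 = 1 and ?N2.0 = 4], rule terminates_Assign, goal_cases)
      case 2
      show ?case
      proof (rule terminates_If[where ?N1.0 = 3], goal_cases)
        case 1
        then have "hit t" using 5 E A by (auto simp: hit_def split: if_splits)
        then show ?case using hit 5 A i T'
          by (intro terminates_Seq[where ?N1.0 = 1 and ?N2.0 = 1] terminates_Assign)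
            (auto simp: correct_def)
      next
        case 2
        then have "\<not> hit t" using 5 E A by (auto simp: hit_def split: if_splits)
        then show ?case using 5 by (intro terminates_Skip) (auto simp: less_Suc_eq correct_reg)
      qed simp
    qed (use 5 A T in simp_all)
  next
    case (6 s')
    obtain z where z: "(z, a, f) \<in> balls m" "(z, b, e) \<in> balls m" by (rule midpoint_entries)
    have "arrs s 4 z \<noteq> 0" using filled z(1) by force
    \<comment> \<open>If the cell of the midpoint holds \<open>Suc a\<close>, the entry of
      \<open>b\<close> is a hit; otherwise the entry of \<open>a\<close> is.\<close>
    then have "\<exists>p\<in>balls m. arrs s 4 (fst p) \<noteq> 0 \<and> arrs s 4 (fst p) \<noteq> Suc (fst (snd p))"
      using z pair(1) by (cases "arrs s 4 z = Suc a") force+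
    then have "\<exists>u<l. hit u" unfolding s(3)[symmetric] hit_def by auto
    then show ?case using 6 by blast
  qed (use s l blen_trans[OF l blen_L] in auto)
qed

lemma terminates_enumerate_balls:
  assumes s: "has_input s" "\<forall>A z. 0 < A \<longrightarrow> arrs s A z = 0"
  shows "terminates B enumerate_balls s (4 * n + m * (15 * L + 8) + 14 * L + 30) correct"
proof -
  let ?init = "\<lambda>s'. has_input s' \<and> regs s' 9 = e \<and> regs s' 10 = f \<and> (\<forall>z. arrs s' 4 z = 0) \<and>
    (\<forall>u<n. entry s' u = (0, u, 0))"
  \<comment> \<open>The empty word has code 0 and distance 0, which arrays 1 and 3 contain by
    default; only the indices are written.\<close>
  have init: "terminates B (For 3 0 (Write 2 (Reg 3) (Reg 3))) s' (4 * n + 3) ?init"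
    if "has_input s'" "regs s' 9 = e" "regs s' 10 = f" "arrs s' = arrs s" for s'
  proof (rule terminates_For[where M = n and N = 1 and I = "\<lambda>i s'. has_input s' \<and> regs s' 9 = e \<and>
      regs s' 10 = f \<and> (\<forall>A z. A \<notin> {0, 2} \<longrightarrow> arrs s' A z = 0) \<and> (\<forall>u<i. arrs s' 2 u = u)"],
      goal_cases)
    case (5 i s')
    then show ?case using blen_owner[of i]
      by (intro terminates_Write) (auto simp: less_Suc_eq)
  qed (use that s blen_n in \<open>auto simp: has_inputD entry_def\<close>)
  have first: "round_inv 0 (set_reg 6 n s')" if "?init s'" for s'
  proof -
    have "entry s' ` {..<n} = balls 0"
      unfolding balls_0 using that by (intro image_cong) auto
    moreover have "(\<Sum>u<n. y ^ weight (entry s' u)) = n" using that by simp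
    ultimately show ?thesis using that by (simp add: round_inv_def)
  qed
  have rounds: "terminates B (For 3 1 (Seq (Assign 5 (Reg 6)) (For 4 5 extend_round))) s'
      (m * (15 * L + 8) + 3) (round_inv m)" if "round_inv 0 s'" for s'
  proof (rule terminates_For[where M = m and N = "15 * L + 5" and I = round_inv], goal_cases)
    case (5 k s')
    show ?case
      by (rule terminates_mono[OF terminates_round[OF 5(2,1,3)] order_refl])
        (auto simp: round_inv_def has_inputD)
  qed (use that blen_m in \<open>auto simp: round_inv_def has_inputD algebra_simps\<close>)
  have last: "terminates B (Seq (For 3 6 fill_table) (For 3 6 search_table)) s' (14 * L + 7) correct"
    if r: "round_inv m s'" for s'
    apply (rule terminates_Seq[where ?N1.0 = "5 * L + 3" and ?N2.0 = "9 * L + 3"])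
     apply (rule terminates_mono[OF terminates_fill_table[of _ "regs s' 6"] order_refl])
           apply (use r round_inv_length[OF r] in \<open>auto simp: round_inv_def\<close>)[7]
    subgoal for s''
      by (rule terminates_search_table[where l = "regs s' 6"]) (use round_inv_length[OF r] in auto)
    apply simp
    done
  show ?thesis unfolding enumerate_balls_def
    apply (rule terminates_Seq[where ?N1.0 = 1 and ?N2.0 = "4 * n + m * (15 * L + 8) + 14 * L + 26"])
     apply (rule terminates_Assign)
       apply (use s blen_d[of f] in \<open>simp add: has_inputD f_def\<close>)
      apply (rule terminates_Seq[where ?N1.0 = 1 and ?N2.0 = "4 * n + m * (15 * L + 8) + 14 * L + 24"])
       apply (rule terminates_Assign)
         apply (use s blen_d[of e] in \<open>simp add: has_inputD e_def\<close>)
        apply (rule terminates_Seq[where ?N1.0 = "4 * n + 3" and ?N2.0 = "m * (15 * L + 8) + 14 * L + 20"])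
         apply (rule terminates_mono[OF init order_refl])
            apply (use s in \<open>simp_all add: has_inputD e_def f_def\<close>)[4]
    subgoal for s'
      apply (rule terminates_Seq[where ?N1.0 = 1 and ?N2.0 = "m * (15 * L + 8) + 14 * L + 15"])
       apply (rule terminates_Assign)
         apply (use blen_n in \<open>simp add: has_inputD\<close>)
        apply (rule terminates_Seq[where ?N1.0 = "m * (15 * L + 8) + 3" and ?N2.0 = "14 * L + 7"])
         apply (rule terminates_mono[OF rounds order_refl])
          apply (use first[of s'] in \<open>simp add: has_inputD(1)\<close>)
         apply (erule last)
        apply simp_all
      done
    apply simp_all
    done
qed

end

section \<open>Choice between the two algorithms and their step counts\<close>

definition closest_pair_program :: com where
  "closest_pair_program =
     Seq (If (Op Less (Op Mul (Const 3) (Reg 1)) (Op Mul (Const 13) (Reg 2)))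
            brute_force enumerate_balls)
       (Seq (Assign 0 (Reg 7)) (Assign 1 (Reg 8)))"

context closest_pair_instance
begin

lemma has_input_input_store: "has_input (input_store n m d xs)"
proof -
  have "i * m + k < n * m \<and> (i * m + k) div m = i \<and> (i * m + k) mod m = k" if "i < n" "k < m" for i k
  proof -
    have "i * m + k < Suc i * m" using that by simp
    also have "\<dots> \<le> n * m" using that by (intro mult_le_mono1) simp
    finally show ?thesis using that by simp
  qed
  then show ?thesis by (simp add: has_input_def input_store_def)
qed

lemma bounded_input_store: "bounded_store B (input_store n m d xs)"
proof -
  have "1 \<le> B" using blen_n blen_pos[of n] by linarith
  moreover have "blen 0 \<le> B" "blen (of_bool c) \<le> B" for c
    using two_le_n by (auto intro!: blen_owner)
  ultimately show ?thesis
    using blen_n blen_m blen_d[of d] by (auto simp: bounded_store_def input_store_def)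
qed

lemma terminates_program:
  assumes "if 3 * m < 13 * d then terminates B brute_force (input_store n m d xs) N correct
     else terminates B enumerate_balls (input_store n m d xs) N correct"
  shows "terminates B closest_pair_program (input_store n m d xs) (N + 6)
    (\<lambda>s'. (regs s' 0, regs s' 1) \<in> {(a, b), (b, a)})"
proof -
  have out: "terminates B (Seq (Assign 0 (Reg 7)) (Assign 1 (Reg 8))) s 3
      (\<lambda>s'. (regs s' 0, regs s' 1) \<in> {(a, b), (b, a)})" if "correct s" for s
  proof -
    have "blen (regs s 7) \<le> B" "blen (regs s 8) \<le> B"
      using that pair by (auto simp: correct_def intro!: blen_owner)
    then show ?thesis using that
      by (intro terminates_Seq[where ?N1.0 = 1 and ?N2.0 = 1] terminates_Assign)
        (auto simp: correct_def)
  qed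
  \<comment> \<open>The guard expresses \<open>\<delta> > 3/13\<close> in integers.\<close>
  have choose: "terminates B (If (Op Less (Op Mul (Const 3) (Reg 1)) (Op Mul (Const 13) (Reg 2)))
      brute_force enumerate_balls) (input_store n m d xs) (N + 1) correct"
    using assms has_inputD[OF has_input_input_store]
    by (intro terminates_If[where ?N1.0 = N]) (simp_all split: if_splits)
  show ?thesis unfolding closest_pair_program_def
    by (rule terminates_Seq[where ?N1.0 = "N + 1" and ?N2.0 = 3])
      (use terminates_mono[OF choose order_refl out] in simp_all)
qed

text \<open>One of the two factors \<open>n\<close> is replaced by Plotkin's bound, whose exponent
  \<open>m - 2 * d\<close> is controlled by \<open>H2_ge\<close>.\<close>

lemma brute_force_steps:
  assumes "3 * m < 13 * d" "2 * d \<le> m"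
  shows "real (n * (n * (4 * m + 18) + 10)) \<le>
    64 * real n * (real m)\<^sup>2 * 2 powr ((H2 (d / m) - d / m) * m)"
proof -
  define X where "X = 2 powr ((H2 (d / m) - d / m) * m)"
  have d: "1 \<le> d" using assms(1) by (cases d) auto
  have "n \<le> 2 ^ (m + 1 - 2 * d) * (2 * d)"
    by (rule plotkin_bound[OF d assms(2), of n "\<lambda>i. xs ! i"]) (auto intro: length_nth d_le_hdist)
  also have "2 ^ (m + 1 - 2 * d) = 2 * 2 ^ (m - 2 * d)" using assms(2) by (simp add: Suc_diff_le)
  also have "2 * 2 ^ (m - 2 * d) * (2 * d) \<le> 2 * 2 ^ (m - 2 * d) * m" using assms(2) by (intro mult_le_mono2)
  finally have "real n \<le> real (2 * 2 ^ (m - 2 * d) * m)" by (simp only: of_nat_le_iff)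
  also have "\<dots> = 2 * real m * 2 powr (real m - 2 * real d)"
    using assms(2) by (simp add: powr_realpow[symmetric] of_nat_diff)
  also have "\<dots> \<le> 2 * real m * X"
  proof -
    have "1 - d / m \<le> H2 (d / m)"
      using assms one_le_m by (intro H2_ge) (auto simp: field_simps)
    then have "(1 - 2 * (d / m)) * m \<le> (H2 (d / m) - d / m) * m"
      by (intro mult_right_mono) auto
    moreover have "(1 - 2 * (d / m)) * m = real m - 2 * real d" using one_le_m by (simp add: field_simps)
    ultimately show ?thesis unfolding X_def by (intro mult_left_mono powr_mono) auto
  qed
  finally have n: "real n \<le> 2 * real m * X" .
  have "n * (4 * m + 18) + 10 \<le> 32 * (n * m)"
  proof -
    have "n * 1 \<le> n * m" "1 * 1 \<le> n * m" using one_le_m two_le_n by (intro mult_le_mono; simp)+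
    then show ?thesis unfolding distrib_left by linarith
  qed
  then have "n * (n * (4 * m + 18) + 10) \<le> n * (32 * (n * m))" by (rule mult_le_mono2)
  then have "real (n * (n * (4 * m + 18) + 10)) \<le> 32 * real n * real m * real n"
    by (simp only: of_nat_le_iff[symmetric, where 'a = real]) (simp add: algebra_simps)
  also have "\<dots> \<le> 32 * real n * real m * (2 * real m * X)"
    using n by (intro mult_left_mono) auto
  finally show ?thesis by (simp add: X_def power2_eq_square algebra_simps)
qed

lemma program_steps:
  assumes d: "2 * d \<le> m" and B: "B = 2 * m + 3 + blen n"
  obtains N where "real N \<le> 426 * real n * (real m)\<^sup>2 * 2 powr ((H2 (d / m) - d / m) * m)"
    "terminates B closest_pair_program (input_store n m d xs) N
       (\<lambda>s'. (regs s' 0, regs s' 1) \<in> {(a, b), (b, a)})"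
proof -
  define X where "X = 2 powr ((H2 (d / m) - d / m) * m)"
  have "\<exists>N. real N \<le> 213 * real n * (real m)\<^sup>2 * X \<and> 6 \<le> N \<and>
    (if 3 * m < 13 * d then terminates B brute_force (input_store n m d xs) N correct
     else terminates B enumerate_balls (input_store n m d xs) N correct)"
  proof (cases "3 * m < 13 * d")
    case True
    let ?N = "n * (n * (4 * m + 18) + 10)"
    have "64 * (real n * (real m)\<^sup>2 * X) \<le> 213 * (real n * (real m)\<^sup>2 * X)"
      by (intro mult_right_mono) (auto simp: X_def)
    then have "real ?N \<le> 213 * real n * (real m)\<^sup>2 * X"
      using brute_force_steps[OF True d, folded X_def] unfolding mult.assoc by linarith
    moreover have "1 * 6 \<le> ?N" using two_le_n by (intro mult_le_mono) auto
    ultimately show ?thesis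
      using True terminates_brute_force[OF has_input_input_store] by (intro exI[of _ ?N]) simp
  next
    case False
    then obtain y :: real where y: "0 < y" "y \<le> 1"
      "(1 + y) ^ m \<le> 3 * real m * X * y ^ (d - d div 2)"
      using ball_weight[OF one_le_m d] unfolding X_def by auto
    \<comment> \<open>\<open>n\<close> times the bound on the size of a ball that
      \<open>ball_weight\<close> yields.\<close>
    define L where "L = nat \<lfloor>3 * real m * X * real n\<rfloor>"
    have X: "0 \<le> X" by (simp add: X_def)
    have L: "real L \<le> 3 * real m * X * real n" using X by (simp add: L_def)
    have list_bound: "l \<le> L" if "real l * y ^ (d - d div 2) \<le> real n * (1 + y) ^ m" for l
    proof -
      have "real l * y ^ (d - d div 2) \<le> real n * (3 * real m * X * y ^ (d - d div 2))"
        using that mult_left_mono[OF y(3), of "real n"] by simp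
      also have "\<dots> = 3 * real m * X * real n * y ^ (d - d div 2)" by simp
      finally have "real l \<le> 3 * real m * X * real n" using y(1) by simp
      then show ?thesis by (simp add: L_def le_nat_floor)
    qed
    have "n \<le> L"
    proof (rule list_bound)
      have "y ^ (d - d div 2) \<le> 1" using y by (intro power_le_one) auto
      also have "1 \<le> (1 + y) ^ m" using y by (intro one_le_power) auto
      finally show "real n * y ^ (d - d div 2) \<le> real n * (1 + y) ^ m" by (intro mult_left_mono) auto
    qed
    have words: "blen (2 ^ m) \<le> m + 1" by (simp add: blen_le_iff)
    have "blen L \<le> B"
    proof -
      \<comment> \<open>The exponent is at most \<open>m\<close>, hence
        \<open>L \<le> 3 * m * 2 ^ m * n\<close>. The lengths of these factors add up to at most
        \<open>2 * m + 3 + blen n\<close>, which is the choice of \<open>B\<close>.\<close>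
      have "H2 (d / m) \<le> 1"
        using d one_le_m by (intro H2_le_1) (auto simp: field_simps)
      moreover have "0 \<le> real d / real m" by simp
      ultimately have "H2 (d / m) - d / m \<le> 1" by linarith
      then have "(H2 (d / m) - d / m) * m \<le> 1 * real m" by (intro mult_right_mono) auto
      then have "X \<le> 2 powr real m" unfolding X_def by (intro powr_mono) auto
      then have "3 * real m * X * real n \<le> 3 * real m * 2 ^ m * real n"
        by (intro mult_right_mono mult_left_mono) (auto simp: powr_realpow)
      then have "real L \<le> real (3 * m * 2 ^ m * n)" using L by simp
      then have "L \<le> 3 * m * 2 ^ m * n" by (simp only: of_nat_le_iff)
      then have "blen L \<le> blen (3 * m * 2 ^ m * n)" by (rule blen_mono)
      also have "\<dots> \<le> blen 3 + blen m + blen (2 ^ m) + blen n"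
        using blen_bop_val[of Mul "3 * m * 2 ^ m" n] blen_bop_val[of Mul "3 * m" "2 ^ m"]
          blen_bop_val[of Mul 3 m] by simp
      also have "\<dots> \<le> 2 + m + (m + 1) + blen n"
        using words one_le_m by (intro add_mono) (auto simp: blen_le_iff less_exp)
      finally show ?thesis by (simp add: B)
    qed
    then interpret ball_enumeration n m d a b xs B "d - d div 2" "d div 2" L y
      using y list_bound words by unfold_locales (auto simp: B)
    let ?N = "4 * n + m * (15 * L + 8) + 14 * L + 30"
    \<comment> \<open>\<open>71 = 4 + 15 + 8 + 14 + 30\<close>: each summand of \<open>?N\<close> is
      at most its coefficient times \<open>m * L\<close>.\<close>
    have "?N \<le> 71 * (m * L)"
    proof -
      have "1 * L \<le> m * L" "m * 1 \<le> m * L" using one_le_m two_le_n \<open>n \<le> L\<close> by (intro mult_le_mono; simp)+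
      then show ?thesis unfolding distrib_left using two_le_n \<open>n \<le> L\<close> by linarith
    qed
    then have "real ?N \<le> real (71 * (m * L))" by (simp only: of_nat_le_iff)
    also have "\<dots> = 71 * real m * real L" by simp
    also have "\<dots> \<le> 71 * real m * (3 * real m * X * real n)" using L by (intro mult_left_mono) auto
    also have "\<dots> = 213 * real n * (real m)\<^sup>2 * X" by (simp add: power2_eq_square)
    finally have "real ?N \<le> 213 * real n * (real m)\<^sup>2 * X" .
    moreover have "terminates B enumerate_balls (input_store n m d xs) ?N correct"
      by (rule terminates_enumerate_balls[OF has_input_input_store]) (simp add: input_store_def)
    ultimately show ?thesis using False by (intro exI[of _ ?N]) simp
  qed
  then obtain N where N: "real N \<le> 213 * real n * (real m)\<^sup>2 * X" "6 \<le> N"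
    "if 3 * m < 13 * d then terminates B brute_force (input_store n m d xs) N correct
     else terminates B enumerate_balls (input_store n m d xs) N correct" by blast
  \<comment> \<open>The 6 steps around the chosen algorithm are absorbed by doubling, so 213 becomes
    426.\<close>
  have "real (N + 6) \<le> 2 * real N" using N(2) by simp
  also have "\<dots> \<le> 2 * (213 * real n * (real m)\<^sup>2 * X)"
    using N(1) by (rule mult_left_mono) simp
  finally show ?thesis using that[of "N + 6"] terminates_program[OF N(3)] by (simp add: X_def)
qed

end

section \<open>Binary length against logarithm, and the time bound\<close>

lemma blen_le_log: "2 \<le> n \<Longrightarrow> real (blen n) \<le> 2 * log 2 n"
proof -
  assume n: "2 \<le> n"
  then have l: "1 \<le> log 2 n" by simp
  then have "real (blen n) = real_of_int \<lfloor>log 2 n\<rfloor> + 1"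
    using n by (simp add: blen_def floorlog_def max_def)
  also have "\<dots> \<le> 2 * log 2 n" using l of_int_floor_le[of "log 2 n"] by linarith
  finally show ?thesis .
qed

theorem mainTheorem1:
  "\<exists>(P :: com) (C :: real) (q :: real poly).
     \<forall>(n :: nat) (m :: nat) (xs :: bool list list) (a :: nat) (b :: nat) (d :: nat) (\<delta> :: real).
       2 \<le> n \<longrightarrow> 1 \<le> m \<longrightarrow>
       length xs = n \<longrightarrow> (\<forall>v \<in> set xs. length v = m) \<longrightarrow>
       unique_closest_pair xs a b \<longrightarrow>
       d = min_dist xs \<longrightarrow> \<delta> = real d / real m \<longrightarrow> \<delta> \<le> 1/2 \<longrightarrow>
       (\<exists>T :: nat.
          real T \<le> C * (real n * (log 2 (real n))\<^sup>2
                        * 2 powr ((1 - zyablov \<delta> - \<delta>) * real m) * poly q (real m)) \<and>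
          halts_within P (input_store n m d xs) T \<and>
          measure_pmf.prob (output_after P (input_store n m d xs) T) {(a, b), (b, a)}
            \<ge> 1 - 1 / (real n)\<^sup>2)"
proof (intro exI[of _ closest_pair_program] exI[of _ "20874 * real (com_weight closest_pair_program)"]
    exI[of _ "monom 1 4"] allI impI)
  fix n m a b d :: nat and xs :: "bool list list" and \<delta> :: real
  assume n: "2 \<le> n" and m: "1 \<le> m" and xs: "length xs = n" "\<forall>v \<in> set xs. length v = m"
    and pair: "unique_closest_pair xs a b" and d: "d = min_dist xs"
    and \<delta>: "\<delta> = real d / real m" "\<delta> \<le> 1/2"
  define B where "B = 2 * m + 3 + blen n"
  define W where "W = com_weight closest_pair_program"
  define lg where "lg = log 2 (real n)"
  define X where "X = 2 powr ((H2 \<delta> - \<delta>) * m)"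
  have "blen m \<le> m" using m by (simp add: blen_le_iff less_exp)
  then interpret closest_pair_instance n m d a b xs B
    using n m xs pair d by unfold_locales (auto simp: B_def)
  have "real d / real m \<le> 1/2" using \<delta> by simp
  then have "2 * d \<le> m" using m by (simp add: field_simps)
  then obtain N where N: "real N \<le> 426 * real n * (real m)\<^sup>2 * X"
    "terminates B closest_pair_program (input_store n m d xs) N
       (\<lambda>s'. (regs s' 0, regs s' 1) \<in> {(a, b), (b, a)})"
    using program_steps[OF _ B_def] unfolding X_def \<delta>(1) by blast
  define T where "T = N * (W * B\<^sup>2)"
  note halt = terminates_halts[OF N(2) bounded_input_store, folded W_def, folded T_def]
  have lg: "1 \<le> lg" using n by (simp add: lg_def)
  \<comment> \<open>\<open>7 = 2 + 3 + 2\<close>, from \<open>2 * m\<close>, the constant 3 and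
    \<open>blen n \<le> 2 * lg\<close>.\<close>
  have "real B \<le> 7 * (real m * lg)"
  proof -
    have "1 \<le> real m" using m by simp
    then have "real m * 1 \<le> real m * lg" "1 * lg \<le> real m * lg" using lg by (intro mult_mono; simp)+
    moreover have "real B = 2 * real m + 3 + real (blen n)" by (simp add: B_def)
    ultimately show ?thesis using blen_le_log[OF n, folded lg_def] lg by linarith
  qed
  then have "(real B)\<^sup>2 \<le> (7 * (real m * lg))\<^sup>2" by (intro power_mono) auto
  also have "\<dots> = 49 * (real m)\<^sup>2 * lg\<^sup>2" by (simp add: power_mult_distrib)
  finally have B2: "(real B)\<^sup>2 \<le> 49 * (real m)\<^sup>2 * lg\<^sup>2" .
  \<comment> \<open>The step count and the square of \<open>B\<close> supply two factors
    \<open>m\<close> each, hence the monomial of degree 4. The square also supplies the squared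
    logarithm, and \<open>20874 = 426 * 49\<close>.\<close>
  have "real T = real N * (real W * (real B)\<^sup>2)" by (simp add: T_def)
  also have "\<dots> \<le> (426 * real n * (real m)\<^sup>2 * X) * (real W * (49 * (real m)\<^sup>2 * lg\<^sup>2))"
    using N(1) B2 by (intro mult_mono mult_left_mono) (auto simp: X_def)
  also have "\<dots> = 20874 * real W * (real n * lg\<^sup>2 * X * real m ^ 4)"
    by (simp add: power2_eq_square power4_eq_xxxx)
  also have "\<dots> \<le> 20874 * real W *
      (real n * lg\<^sup>2 * 2 powr ((1 - zyablov \<delta> - \<delta>) * real m) * real m ^ 4)"
  proof -
    have "(H2 \<delta> - \<delta>) * m \<le> (1 - zyablov \<delta> - \<delta>) * real m"
      using zyablov_le[of \<delta>] \<delta> by (intro mult_right_mono) auto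
    then have "X \<le> 2 powr ((1 - zyablov \<delta> - \<delta>) * real m)"
      unfolding X_def by (intro powr_mono) auto
    then show ?thesis by (intro mult_left_mono mult_right_mono) auto
  qed
  finally have "real T \<le> 20874 * real W * (real n * lg\<^sup>2 * 2 powr ((1 - zyablov \<delta> - \<delta>) * real m) *
      poly (monom 1 4) (real m))" by (simp add: poly_monom)
  moreover have "measure_pmf.prob (output_after closest_pair_program (input_store n m d xs) T)
      {(a, b), (b, a)} = 1" by (rule halt(2))
  ultimately show "\<exists>T :: nat. real T \<le> 20874 * real (com_weight closest_pair_program) *
        (real n * (log 2 (real n))\<^sup>2 * 2 powr ((1 - zyablov \<delta> - \<delta>) * real m) * poly (monom 1 4) (real m)) \<and>
      halts_within closest_pair_program (input_store n m d xs) T \<and>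
      measure_pmf.prob (output_after closest_pair_program (input_store n m d xs) T) {(a, b), (b, a)}
        \<ge> 1 - 1 / (real n)\<^sup>2"
    using halt(1) by (intro exI[of _ T]) (simp add: W_def lg_def)
qed

end
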